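(* Let $1<p<\infty$ and let $g\in L^\infty$ be a matching function (i.e. $g\widetilde g=1$) such that the operator $T(g):H^p\to H^p$ is Fredholm and $n:=\operatorname{ind}T(g)>0$. If $g=g_-t^{-n}g_+$, $g_-(\infty)=1$, is the corresponding Wiener--Hopf factorization of $g$ in $H^p$, then the following systems of functions $\mathcal{B}_{\pm}(g)$ form bases in the spaces $\operatorname{im}\mathbf{P}_g^{\pm}$, respectively: (i) If $n=2m$, $m\in\mathbb{N}$, then $$\mathcal{B}_{\pm}(g):=\{g_+^{-1}(t^{m-k-1}\pm\boldsymbol\sigma(g)t^{m+k}):k=0,1,\dots,m-1\},$$ and $\dim\operatorname{im}\mathbf{P}_g^{\pm}=m$. (ii) If $n=2m+1$, $m\in\mathbb{Z}_+$, then $$\mathcal{B}_{\pm}(g):=\{g_+^{-1}(t^{m+k}\pm\boldsymbol\sigma(g)t^{m-k}):k=0,1,\dots,m\}\setminus\{0\},$$ $$\dim\operatorname{im}\mathbf{P}_g^{\pm}=m+\frac{1\pm\boldsymbol\sigma(g)}{2},$$ and the zero element (removed above) occurs for only one of the two systems $\mathcal{B}_+(g)$, $\mathcal{B}_-(g)$: namely, for $k=0$ one of the terms $t^m(1\pm\boldsymbol\sigma(g))$ is equal to zero.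
   Context: $\mathbb{T}$ is the unit circle, $L^p=L^p(\mathbb{T})$, $1/p+1/q=1$, $H^p=\{f\in L^p:\widehat f_n=0\text{ for }n<0\}$, $\overline{H^p}=\{f\in L^p:\widehat f_n=0\text{ for }n>0\}$; for $f\in H^p$, $f(0)=\widehat f_0$, and for $f\in\overline{H^p}$, $f(\infty)=\widehat f_0$. $P$ is the Riesz projection of $L^p$ onto $H^p$, $Q=I-P$, $(Jf)(t)=\overline tf(\overline t)$, $\widetilde a(t)=a(1/t)$, $T(a)f=P(af)$ on $H^p$. $\mathbb{Z}_+=\mathbb{N}\cup\{0\}$. The index is $\dim\ker-\dim\operatorname{coker}$. Wiener--Hopf factorization of $a\in L^\infty$ in $H^p$: $a=a_-t^{\nu}a_+$ with $\nu\in\mathbb{Z}$, $a_+\in H^q$, $a_+^{-1}\in H^p$, $a_-\in\overline{H^p}$, $a_-^{-1}\in\overline{H^q}$, $a_-(\infty)=1$, such that the operator $a_+^{-1}Pa_-^{-1}I$, defined on $\operatorname{span}\{t^k:k\in\mathbb{Z}_+\}$, extends boundedly to $H^p$. It is unique, and it exists if and only if $T(a)$ is Fredholm on $H^p$, in which case $\nu=-\operatorname{ind}T(a)$. For a matching function $g$ with $T(g)$ Fredholm on $H^p$, $g_+(0)\in\{1,-1\}$; the factorization signature is $\boldsymbol\sigma(g):=g_+(0)$. $\mathbf{P}_g:=JQgP|_{\ker T(g)}$ maps $\ker T(g)$ into itself with $\mathbf{P}_g^2=I$, and $\mathbf{P}_g^{\pm}:=\frac12(I\pm\mathbf{P}_g)$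 are complementary projections on $\ker T(g)$. *)

theory Defs
  imports "HOL-Analysis.Analysis"
begin

text \<open>Normalised arc length on the unit circle, as a Borel measure on the complex plane.\<close>

definition circle_measure :: "complex measure" where
  "circle_measure = distr (uniform_measure lborel {-pi..pi}) borel cis"

lemma cis_borel [measurable]: "cis \<in> borel_measurable borel"
  by (intro borel_measurable_continuous_onI continuous_intros)

lemma sets_circle_measure [simp, measurable_cong]: "sets circle_measure = sets borel"
  by (simp add: circle_measure_def)

lemma space_circle_measure [simp]: "space circle_measure = UNIV"
  by (simp add: circle_measure_def)

lemma measurable_circle_measureI: "T \<in> borel_measurable borel \<Longrightarrow> T \<in> borel_measurable circle_measure"
  by (simp only: measurable_cong_sets[OF sets_circle_measure refl])

lemma emeasure_circle_measure:
  "A \<in> sets borel \<Longrightarrow>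
     emeasure circle_measure A = emeasure lborel ({-pi..pi} \<inter> cis -` A) / emeasure lborel {-pi..pi}"
  using measurable_sets[OF cis_borel, of A]
  by (simp add: circle_measure_def emeasure_distr)

lemma prob_circle_measure: "emeasure circle_measure UNIV = 1"
  by (subst emeasure_circle_measure) (auto simp: ennreal_divide_self)

text \<open>Invariance under the reflection \<open>t \<mapsto> 1/t\<close> (which is conjugation on the circle).\<close>

lemma distr_circle_measure_reflect:
  assumes "T \<in> borel_measurable borel" and T: "\<And>x. T (cis x) = cis (- x)"
  shows "distr circle_measure borel T = circle_measure"
proof (rule measure_eqI)
  fix A assume "A \<in> sets (distr circle_measure borel T)"
  then have A: "A \<in> sets borel" by simp
  define E where "E = {-pi..pi} \<inter> cis -` A"
  have TA: "T -` A \<in> sets borel"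
    using measurable_sets[OF assms(1) A] by simp
  have "cis -` A \<in> sets borel"
    using measurable_sets[OF cis_borel A] by simp
  then have E: "E \<in> sets borel"
    unfolding E_def by (intro sets.Int) simp_all
  have refl: "{-pi..pi} \<inter> cis -` (T -` A) = uminus -` E"
    unfolding E_def by (intro set_eqI) (auto simp only: vimage_eq Int_iff T atLeastAtMost_iff minus_le_iff neg_le_iff_le)
  have "emeasure lborel (uminus -` E) = emeasure (distr lborel borel uminus) E"
    using E by (subst emeasure_distr) simp_all
  then have E_refl: "emeasure lborel (uminus -` E) = emeasure lborel E"
    by (simp only: lborel_distr_uminus)
  have "emeasure (distr circle_measure borel T) A = emeasure circle_measure (T -` A)"
    using emeasure_distr[OF measurable_circle_measureI[OF assms(1)] A] by simp
  then show "emeasure (distr circle_measure borel T) A = emeasure circle_measure A"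
    unfolding emeasure_circle_measure[OF TA] emeasure_circle_measure[OF A] refl E_refl
    by (simp only: E_def)
qed simp

lemma AE_circle_reflect:
  assumes "T \<in> borel_measurable borel" "\<And>x. T (cis x) = cis (- x)"
    and "AE z in circle_measure. P z"
  shows "AE z in circle_measure. P (T z)"
proof -
  have "AE z in distr circle_measure borel T. P z"
    using assms(3) by (simp only: distr_circle_measure_reflect[OF assms(1,2)])
  then show ?thesis
    by (rule AE_distrD[OF measurable_circle_measureI[OF assms(1)]])
qed

text \<open>\<open>circle_fun\<close> consists of the Borel functions on the circle modulo equality almost everywhere;
  values off the circle are irrelevant, since \<open>circle_measure\<close> does not charge them.\<close>

definition circle_eq :: "(complex \<Rightarrow> complex) \<Rightarrow> (complex \<Rightarrow> complex) \<Rightarrow> bool" where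
  "circle_eq f g \<longleftrightarrow> f \<in> borel_measurable borel \<and> g \<in> borel_measurable borel \<and>
     (AE z in circle_measure. f z = g z)"

quotient_type circle_fun = "complex \<Rightarrow> complex" / partial: circle_eq
proof (rule part_equivpI)
  show "\<exists>f. circle_eq f f"
    by (rule exI[of _ "\<lambda>_. 0"]) (simp add: circle_eq_def)
  show "symp circle_eq"
    by (auto intro!: sympI simp: circle_eq_def)
  show "transp circle_eq"
  proof (rule transpI)
    fix f g h assume "circle_eq f g" "circle_eq g h"
    then have "AE z in circle_measure. f z = g z" "AE z in circle_measure. g z = h z"
      by (simp_all add: circle_eq_def)
    then have "AE z in circle_measure. f z = h z"
      by eventually_elim simp
    with \<open>circle_eq f g\<close> \<open>circle_eq g h\<close> show "circle_eq f h"
      by (simp add: circle_eq_def)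
  qed
qed

lemma circle_eq_map1:
  fixes F :: "complex \<Rightarrow> complex"
  assumes "circle_eq f f'" and "\<And>h :: complex \<Rightarrow> complex. h \<in> borel_measurable borel \<Longrightarrow> (\<lambda>z. F (h z)) \<in> borel_measurable borel"
  shows "circle_eq (\<lambda>z. F (f z)) (\<lambda>z. F (f' z))"
proof -
  have "AE z in circle_measure. f z = f' z"
    using assms(1) by (simp add: circle_eq_def)
  then have "AE z in circle_measure. F (f z) = F (f' z)"
    by eventually_elim simp
  moreover have "f \<in> borel_measurable borel" "f' \<in> borel_measurable borel"
    using assms(1) by (simp_all add: circle_eq_def)
  ultimately show ?thesis
    unfolding circle_eq_def by (intro conjI assms(2))
qed

lemma circle_eq_map2:
  fixes F :: "complex \<Rightarrow> complex \<Rightarrow> complex"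
  assumes "circle_eq f f'" "circle_eq g g'"
    and "\<And>h k :: complex \<Rightarrow> complex. h \<in> borel_measurable borel \<Longrightarrow> k \<in> borel_measurable borel \<Longrightarrow>
           (\<lambda>z. F (h z) (k z)) \<in> borel_measurable borel"
  shows "circle_eq (\<lambda>z. F (f z) (g z)) (\<lambda>z. F (f' z) (g' z))"
proof -
  have "AE z in circle_measure. f z = f' z" "AE z in circle_measure. g z = g' z"
    using assms(1,2) by (simp_all add: circle_eq_def)
  then have "AE z in circle_measure. F (f z) (g z) = F (f' z) (g' z)"
    by eventually_elim simp
  moreover have "f \<in> borel_measurable borel" "f' \<in> borel_measurable borel"
      "g \<in> borel_measurable borel" "g' \<in> borel_measurable borel"
    using assms(1,2) by (simp_all add: circle_eq_def)
  ultimately show ?thesis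
    unfolding circle_eq_def by (intro conjI assms(3))
qed

instantiation circle_fun :: comm_ring_1
begin

lift_definition zero_circle_fun :: circle_fun is "\<lambda>_. 0" by (simp add: circle_eq_def)

lift_definition one_circle_fun :: circle_fun is "\<lambda>_. 1" by (simp add: circle_eq_def)

lift_definition plus_circle_fun :: "circle_fun \<Rightarrow> circle_fun \<Rightarrow> circle_fun"
  is "\<lambda>f g z. f z + g z"
  by (rule circle_eq_map2[where F = "(+)"]; (assumption | rule borel_measurable_add)+)

lift_definition minus_circle_fun :: "circle_fun \<Rightarrow> circle_fun \<Rightarrow> circle_fun"
  is "\<lambda>f g z. f z - g z"
  by (rule circle_eq_map2[where F = "(-)"]; (assumption | rule borel_measurable_diff)+)

lift_definition times_circle_fun :: "circle_fun \<Rightarrow> circle_fun \<Rightarrow> circle_fun"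
  is "\<lambda>f g z. f z * g z"
  by (rule circle_eq_map2[where F = "(*)"]; (assumption | rule borel_measurable_times)+)

lift_definition uminus_circle_fun :: "circle_fun \<Rightarrow> circle_fun"
  is "\<lambda>f z. - f z"
  by (rule circle_eq_map1[where F = uminus]; (assumption | rule borel_measurable_uminus)+)

instance
proof
  have "\<not> (AE z in circle_measure. (0::complex) = 1)"
    using prob_circle_measure by (simp add: AE_iff_measurable[OF _ refl])
  then show "(0::circle_fun) \<noteq> 1"
    by transfer (simp add: circle_eq_def)
qed (transfer; simp add: circle_eq_def algebra_simps)+

end

text \<open>The inverse is taken pointwise (with \<open>inverse 0 = 0\<close>); the condition
  \<open>f * inverse f = 1\<close> says that \<open>f\<close> is nonzero almost everywhere.\<close>

instantiation circle_fun :: inverse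
begin

lift_definition inverse_circle_fun :: "circle_fun \<Rightarrow> circle_fun"
  is "\<lambda>f z. inverse (f z)"
  by (rule circle_eq_map1[where F = inverse]; (assumption | rule borel_measurable_inverse)+)

definition divide_circle_fun :: "circle_fun \<Rightarrow> circle_fun \<Rightarrow> circle_fun" where
  "divide_circle_fun f g = f * inverse g"

instance ..

end

lift_definition cscale :: "complex \<Rightarrow> circle_fun \<Rightarrow> circle_fun" (infixr "*\<^sub>C" 75)
  is "\<lambda>c f z. c * f z"
  by (rule_tac F = "\<lambda>x. complex * x" in circle_eq_map1)
     (assumption | rule borel_measurable_times borel_measurable_const)+

global_interpretation circle: vector_space cscale
  by standard (transfer; simp add: circle_eq_def algebra_simps)+

lemma powi_borel: "(\<lambda>z::complex. z powi k) \<in> borel_measurable borel"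
  unfolding power_int_def by (cases "k \<ge> 0") simp_all

lift_definition tpow :: "int \<Rightarrow> circle_fun" is "\<lambda>k z. z powi k"
  by (simp add: circle_eq_def powi_borel)

lift_definition reflect :: "circle_fun \<Rightarrow> circle_fun" is "\<lambda>f z. f (1 / z)"
proof -
  fix f g assume fg: "circle_eq f g"
  then have [measurable]: "f \<in> borel_measurable borel" "g \<in> borel_measurable borel"
    by (auto simp: circle_eq_def)
  have "AE z in circle_measure. f (1 / z) = g (1 / z)"
    using fg by (intro AE_circle_reflect[of "\<lambda>z. 1 / z"]) (auto simp: circle_eq_def divide_inverse)
  then show "circle_eq (\<lambda>z. f (1 / z)) (\<lambda>z. g (1 / z))"
    by (simp add: circle_eq_def)
qed

lift_definition flip_J :: "circle_fun \<Rightarrow> circle_fun" is "\<lambda>f z. cnj z * f (cnj z)"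
proof -
  fix f g assume fg: "circle_eq f g"
  then have [measurable]: "f \<in> borel_measurable borel" "g \<in> borel_measurable borel"
    by (auto simp: circle_eq_def)
  have cnj [measurable]: "cnj \<in> borel_measurable borel"
    by (intro borel_measurable_continuous_onI continuous_intros)
  have "AE z in circle_measure. f (cnj z) = g (cnj z)"
    using fg by (intro AE_circle_reflect[of cnj]) (auto simp: circle_eq_def cis_cnj)
  then have "AE z in circle_measure. cnj z * f (cnj z) = cnj z * g (cnj z)"
    by eventually_elim simp
  then show "circle_eq (\<lambda>z. cnj z * f (cnj z)) (\<lambda>z. cnj z * g (cnj z))"
    by (simp add: circle_eq_def)
qed

lift_definition in_Lp :: "real \<Rightarrow> circle_fun \<Rightarrow> bool"
  is "\<lambda>p f. integrable circle_measure (\<lambda>z. norm (f z) powr p)"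
proof -
  fix p :: real and f g assume fg: "circle_eq f g"
  then have [measurable]: "f \<in> borel_measurable borel" "g \<in> borel_measurable borel"
    by (auto simp: circle_eq_def)
  have "AE z in circle_measure. f z = g z"
    using fg by (simp add: circle_eq_def)
  then have "AE z in circle_measure. norm (f z) powr p = norm (g z) powr p"
    by eventually_elim simp
  then show "integrable circle_measure (\<lambda>z. norm (f z) powr p) =
        integrable circle_measure (\<lambda>z. norm (g z) powr p)"
    by (intro integrable_cong_AE) measurable
qed

lift_definition in_Linf :: "circle_fun \<Rightarrow> bool"
  is "\<lambda>f. \<exists>C. AE z in circle_measure. norm (f z) \<le> C"
proof -
  fix f g assume "circle_eq f g"
  then have "AE z in circle_measure. f z = g z"
    by (simp add: circle_eq_def)
  then have "AE z in circle_measure. (norm (f z) \<le> C) = (norm (g z) \<le> C)" for C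
    by eventually_elim simp
  then have "(AE z in circle_measure. norm (f z) \<le> C) \<longleftrightarrow> (AE z in circle_measure. norm (g z) \<le> C)" for C
    by (rule eventually_subst)
  then show "(\<exists>C. AE z in circle_measure. norm (f z) \<le> C) \<longleftrightarrow> (\<exists>C. AE z in circle_measure. norm (g z) \<le> C)"
    by simp
qed

lift_definition Lp_norm :: "real \<Rightarrow> circle_fun \<Rightarrow> real"
  is "\<lambda>p f. (LINT z|circle_measure. norm (f z) powr p) powr (1 / p)"
proof -
  fix p :: real and f g assume fg: "circle_eq f g"
  then have [measurable]: "f \<in> borel_measurable borel" "g \<in> borel_measurable borel"
    by (auto simp: circle_eq_def)
  have "AE z in circle_measure. f z = g z"
    using fg by (simp add: circle_eq_def)
  then have "AE z in circle_measure. norm (f z) powr p = norm (g z) powr p"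
    by eventually_elim simp
  then have "(LINT z|circle_measure. norm (f z) powr p) = (LINT z|circle_measure. norm (g z) powr p)"
    by (intro integral_cong_AE) measurable
  then show "(LINT z|circle_measure. norm (f z) powr p) powr (1 / p) =
             (LINT z|circle_measure. norm (g z) powr p) powr (1 / p)"
    by simp
qed

text \<open>Meaningful for functions in \<open>L\<^sup>1\<close> only.\<close>

lift_definition fourier :: "circle_fun \<Rightarrow> int \<Rightarrow> complex"
  is "\<lambda>f n. LINT z|circle_measure. f z * z powi (- n)"
proof (rule ext)
  fix f g and n :: int assume fg: "circle_eq f g"
  then have [measurable]: "f \<in> borel_measurable borel" "g \<in> borel_measurable borel"
    by (auto simp: circle_eq_def)
  note [measurable] = powi_borel
  have "AE z in circle_measure. f z = g z"
    using fg by (simp add: circle_eq_def)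
  then have "AE z in circle_measure. f z * z powi (- n) = g z * z powi (- n)"
    by eventually_elim simp
  then show "(LINT z|circle_measure. f z * z powi (- n)) = (LINT z|circle_measure. g z * z powi (- n))"
    by (intro integral_cong_AE) measurable
qed

definition Lp :: "real \<Rightarrow> circle_fun set" where
  "Lp p = {f. in_Lp p f}"

definition Linf :: "circle_fun set" where
  "Linf = {f. in_Linf f}"

definition Hp :: "real \<Rightarrow> circle_fun set" where
  "Hp p = {f \<in> Lp p. \<forall>n<0. fourier f n = 0}"

definition Hp_bar :: "real \<Rightarrow> circle_fun set" where
  "Hp_bar p = {f \<in> Lp p. \<forall>n>0. fourier f n = 0}"

text \<open>\<open>f(0)\<close> for \<open>f \<in> Hp p\<close>, and \<open>f(\<infinity>)\<close> for \<open>f \<in> Hp_bar p\<close>.\<close>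

definition at_zero :: "circle_fun \<Rightarrow> complex" where
  "at_zero f = fourier f 0"

definition at_infty :: "circle_fun \<Rightarrow> complex" where
  "at_infty f = fourier f 0"

definition conj_exponent :: "real \<Rightarrow> real" where
  "conj_exponent p = p / (p - 1)"

text \<open>The Riesz projection of \<open>L\<^sup>p\<close> onto \<open>H\<^sup>p\<close> cuts off the Fourier coefficients of negative
  index. For \<open>f \<in> L\<^sup>p\<close> and \<open>1 < p < \<infinity>\<close> the described element exists by the theorem of M. Riesz and
  is unique, because an integrable function is determined by its Fourier coefficients.\<close>

definition riesz_P :: "real \<Rightarrow> circle_fun \<Rightarrow> circle_fun" where
  "riesz_P p f = (THE h. h \<in> Hp p \<and> (\<forall>n\<ge>0. fourier h n = fourier f n))"

definition riesz_Q :: "real \<Rightarrow> circle_fun \<Rightarrow> circle_fun" where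
  "riesz_Q p f = f - riesz_P p f"

definition toeplitz :: "real \<Rightarrow> circle_fun \<Rightarrow> circle_fun \<Rightarrow> circle_fun" where
  "toeplitz p a f = riesz_P p (a * f)"

definition bounded_operator_Hp :: "real \<Rightarrow> (circle_fun \<Rightarrow> circle_fun) \<Rightarrow> bool" where
  "bounded_operator_Hp p A \<longleftrightarrow>
     (\<forall>f\<in>Hp p. A f \<in> Hp p) \<and>
     (\<forall>f\<in>Hp p. \<forall>g\<in>Hp p. A (f + g) = A f + A g) \<and>
     (\<forall>c. \<forall>f\<in>Hp p. A (c *\<^sub>C f) = c *\<^sub>C A f) \<and>
     (\<exists>C. \<forall>f\<in>Hp p. Lp_norm p (A f) \<le> C * Lp_norm p f)"

definition ker_Hp :: "real \<Rightarrow> (circle_fun \<Rightarrow> circle_fun) \<Rightarrow> circle_fun set" where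
  "ker_Hp p A = {f \<in> Hp p. A f = 0}"

definition finite_dimensional :: "circle_fun set \<Rightarrow> bool" where
  "finite_dimensional V \<longleftrightarrow> (\<exists>B. finite B \<and> V \<subseteq> circle.span B)"

text \<open>The quotient \<open>X/Y\<close> of a space by a subspace is treated through representatives: the cosets of
  \<open>B \<subseteq> X\<close> span \<open>X/Y\<close> iff \<open>span (Y \<union> B) = X\<close>. Its dimension is the least size of such a \<open>B\<close>.\<close>

definition spans_modulo :: "circle_fun set \<Rightarrow> circle_fun set \<Rightarrow> circle_fun set \<Rightarrow> bool" where
  "spans_modulo X Y B \<longleftrightarrow> B \<subseteq> X \<and> circle.span (Y \<union> B) = X"

definition finite_codim :: "circle_fun set \<Rightarrow> circle_fun set \<Rightarrow> bool" where
  "finite_codim X Y \<longleftrightarrow> (\<exists>B. finite B \<and> spans_modulo X Y B)"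

definition codim :: "circle_fun set \<Rightarrow> circle_fun set \<Rightarrow> nat" where
  "codim X Y = (LEAST k. \<exists>B. finite B \<and> card B = k \<and> spans_modulo X Y B)"

definition Lp_closed_in_Hp :: "real \<Rightarrow> circle_fun set \<Rightarrow> bool" where
  "Lp_closed_in_Hp p Y \<longleftrightarrow>
     (\<forall>y f. (\<forall>k::nat. y k \<in> Y) \<and> f \<in> Hp p \<and> (\<lambda>k. Lp_norm p (y k - f)) \<longlonglongrightarrow> 0 \<longrightarrow> f \<in> Y)"

text \<open>Being a bounded linear operator on \<open>H\<^sup>p\<close> is part of being Fredholm; every Toeplitz operator
  with a bounded symbol has this property.\<close>

definition fredholm_Hp :: "real \<Rightarrow> (circle_fun \<Rightarrow> circle_fun) \<Rightarrow> bool" where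
  "fredholm_Hp p A \<longleftrightarrow>
     bounded_operator_Hp p A \<and>
     Lp_closed_in_Hp p (A ` Hp p) \<and>
     finite_dimensional (ker_Hp p A) \<and>
     finite_codim (Hp p) (A ` Hp p)"

definition fredholm_index :: "real \<Rightarrow> (circle_fun \<Rightarrow> circle_fun) \<Rightarrow> int" where
  "fredholm_index p A = int (circle.dim (ker_Hp p A)) - int (codim (Hp p) (A ` Hp p))"

text \<open>The operator \<open>B\<close> is the bounded extension to \<open>H\<^sup>p\<close>. The projection inside it acts on
  \<open>inverse a_minus * f\<close>, an element of \<open>L\<^sup>q\<close>.\<close>

definition wiener_hopf ::
    "real \<Rightarrow> circle_fun \<Rightarrow> circle_fun \<Rightarrow> int \<Rightarrow> circle_fun \<Rightarrow> bool" where
  "wiener_hopf p a a_minus \<nu> a_plus \<longleftrightarrow>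
     (let q = conj_exponent p in
       a = a_minus * tpow \<nu> * a_plus \<and>
       a_plus * inverse a_plus = 1 \<and> a_minus * inverse a_minus = 1 \<and>
       a_plus \<in> Hp q \<and> inverse a_plus \<in> Hp p \<and>
       a_minus \<in> Hp_bar p \<and> inverse a_minus \<in> Hp_bar q \<and>
       at_infty a_minus = 1 \<and>
       (\<exists>B. bounded_operator_Hp p B \<and>
         (\<forall>f \<in> circle.span (range (\<lambda>k::nat. tpow (int k))).
            B f = inverse a_plus * riesz_P q (inverse a_minus * f))))"

definition matching :: "circle_fun \<Rightarrow> bool" where
  "matching g \<longleftrightarrow> g * reflect g = 1"

text \<open>The value at \<open>0\<close> of the plus factor, which is unique by uniqueness of the factorization.\<close>

definition fact_signature :: "real \<Rightarrow> circle_fun \<Rightarrow> complex" where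
  "fact_signature p g =
     (THE s. \<exists>g_minus \<nu> g_plus. wiener_hopf p g g_minus \<nu> g_plus \<and> s = at_zero g_plus)"

definition PP :: "real \<Rightarrow> circle_fun \<Rightarrow> circle_fun \<Rightarrow> circle_fun" where
  "PP p g f = flip_J (riesz_Q p (g * riesz_P p f))"

text \<open>The image on \<open>ker T(g)\<close> of \<open>1/2 (I + s P\<^sub>g)\<close>; the sign \<open>s\<close> is \<open>1\<close> or \<open>-1\<close>.\<close>

definition im_PP :: "complex \<Rightarrow> real \<Rightarrow> circle_fun \<Rightarrow> circle_fun set" where
  "im_PP s p g = (\<lambda>f. (1 / 2) *\<^sub>C (f + s *\<^sub>C PP p g f)) ` ker_Hp p (toeplitz p g)"

definition is_basis :: "circle_fun set \<Rightarrow> circle_fun set \<Rightarrow> bool" where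
  "is_basis B V \<longleftrightarrow> circle.independent B \<and> circle.span B = V"

end

theory Submission
  imports Defs
begin

text \<open>If \<open>a b = c d\<close> with \<open>a, b\<close> in conjugate Hardy spaces and \<open>c, d\<close> in conjugate spaces of
  anti-analytic functions, then the common value is a constant. Inserting \<open>g = g\<^sub>- t\<^sup>-\<^sup>n g\<^sub>+\<close>
  into the matching condition, one concludes that the reflection of \<open>g\<^sub>-\<close> is \<open>\<sigma> g\<^sub>+\<^sup>-\<^sup>1\<close> with \<open>\<sigma> = g\<^sub>+(0)\<close> and
  \<open>\<sigma>\<^sup>2 = 1\<close>. The same principle identifies the kernel of \<open>T(g)\<close> with the span of
  \<open>e\<^sub>k = g\<^sub>+\<^sup>-\<^sup>1 t\<^sup>k\<close>, \<open>0 \<le> k < n\<close>. Since \<open>g e\<^sub>k = g\<^sub>- t\<^sup>k\<^sup>-\<^sup>n\<close>, the operator \<open>P\<^sub>g\<close> maps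
  \<open>e\<^sub>k\<close> to \<open>\<sigma> e\<^sub>n\<^sub>-\<^sub>1\<^sub>-\<^sub>k\<close>, and the bases are the symmetrizations of the \<open>e\<^sub>k\<close>.\<close>

text \<open>The principle rests on \<open>fourier (f * h) n = fourier f n * fourier h 0\<close> for
  n <= 0, with f in H^p and h in H^q. As f h is merely integrable, this cannot be read off by
  multiplying two Fourier series; it comes from the rotation invariance of the measure and the fact
  that an L^1 function with vanishing Fourier coefficients is zero. Reflection gives the mirror
  formula, so in a b = c d one side excludes negative frequencies and the other positive ones.

  Two notions are defined by description, which creates obligations: the signature has a value
  because the plus factor is unique, and \<open>riesz_P\<close> projects only where the described
  function exists, which is extracted from the Fredholm hypothesis.

  The dimension halves because \<open>\<sigma>\<close> squares to 1: up to sign, e_k and e_(n-1-k)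
  have the same symmetrization. For n = 2m + 1 the middle index m is paired with itself, so its
  symmetrization is 0 for one of the two signs.\<close>

interpretation circle_measure: finite_measure circle_measure
  by standard (simp add: prob_circle_measure)

lemma AE_circle_norm: "AE z in circle_measure. norm z = 1"
proof -
  have "AE x in uniform_measure lborel {-pi..pi}. norm (cis x) = 1" by simp
  moreover have "cis \<in> borel_measurable (uniform_measure lborel {-pi..pi})" by simp
  ultimately show ?thesis
    unfolding circle_measure_def by (subst AE_distr_iff) simp_all
qed

section \<open>Rotations of the circle\<close>

lemma emeasure_lborel_shift:
  fixes a :: real
  assumes "A \<in> sets borel"
  shows "emeasure lborel ((+) a -` A) = emeasure lborel A"
proof -
  have "emeasure lborel ((+) a -` A) = emeasure (distr lborel borel ((+) a)) A"
    using assms by (subst emeasure_distr) simp_all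
  then show ?thesis by (simp only: lborel_distr_plus)
qed

text \<open>Shifting the window [-pi, pi) by a drops [-pi, a - pi) on the left and gains [pi, a +
  pi) on the right; by periodicity these are 2 pi translates of one another. Half-open intervals
  keep the pieces disjoint.\<close>

lemma emeasure_lborel_periodic:
  fixes E :: "real set" and a :: real
  assumes E: "E \<in> sets borel" and per: "\<And>x. x + 2 * pi \<in> E \<longleftrightarrow> x \<in> E" and a: "0 \<le> a" "a \<le> 2 * pi"
  shows "emeasure lborel ({-pi..<pi} \<inter> (+) a -` E) = emeasure lborel ({-pi..<pi} \<inter> E)"
proof -
  have E1: "{a - pi..<pi} \<inter> E \<in> sets borel" "{-pi..<a-pi} \<inter> E \<in> sets borel"
    "{pi..<a+pi} \<inter> E \<in> sets borel" "{a-pi..<a+pi} \<inter> E \<in> sets borel" using E by auto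
  have "{-pi..<pi} \<inter> (+) a -` E = (+) a -` ({a-pi..<a+pi} \<inter> E)" by auto
  then have "emeasure lborel ({-pi..<pi} \<inter> (+) a -` E) = emeasure lborel ({a-pi..<a+pi} \<inter> E)"
    using emeasure_lborel_shift[OF E1(4), of a] by simp
  also have "{a-pi..<a+pi} \<inter> E = ({a-pi..<pi} \<inter> E) \<union> ({pi..<a+pi} \<inter> E)"
    using a by auto
  also have "emeasure lborel \<dots> = emeasure lborel ({a-pi..<pi} \<inter> E) + emeasure lborel ({pi..<a+pi} \<inter> E)"
    by (rule plus_emeasure[symmetric]) (use E1 in auto)
  also have "emeasure lborel ({pi..<a+pi} \<inter> E) = emeasure lborel ((+) (2*pi) -` ({pi..<a+pi} \<inter> E))"
    using emeasure_lborel_shift[OF E1(3), of "2*pi"] by simp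
  also have "(+) (2*pi) -` ({pi..<a+pi} \<inter> E) = {-pi..<a-pi} \<inter> E"
  proof (rule set_eqI)
    fix x
    have "2 * pi + x \<in> E \<longleftrightarrow> x \<in> E" using per[of x] by (simp only: add.commute)
    then show "x \<in> (+) (2*pi) -` ({pi..<a+pi} \<inter> E) \<longleftrightarrow> x \<in> {-pi..<a-pi} \<inter> E" by auto
  qed
  also have "emeasure lborel ({a-pi..<pi} \<inter> E) + emeasure lborel ({-pi..<a-pi} \<inter> E)
     = emeasure lborel (({a-pi..<pi} \<inter> E) \<union> ({-pi..<a-pi} \<inter> E))"
    by (rule plus_emeasure) (use E1 in auto)
  also have "({a-pi..<pi} \<inter> E) \<union> ({-pi..<a-pi} \<inter> E) = {-pi..<pi} \<inter> E"
    using a by auto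
  finally show ?thesis .
qed

lemma distr_circle_measure_rotate:
  assumes "norm w = 1"
  shows "distr circle_measure borel (\<lambda>z. w * z) = circle_measure"
proof (rule measure_eqI)
  fix A assume "A \<in> sets (distr circle_measure borel (\<lambda>z. w * z))"
  then have A: "A \<in> sets borel" by simp
  obtain a where a: "w = cis a" "0 \<le> a" "a \<le> 2 * pi"
  proof -
    have "w = cis (Arg2pi w)" using assms Arg2pi_eq[of w] by (simp add: cis_conv_exp)
    with that[of "Arg2pi w"] Arg2pi[of w] show ?thesis by simp
  qed
  define E where "E = cis -` A"
  have wA: "(\<lambda>z. w * z) -` A \<in> sets borel"
    using measurable_sets[of "\<lambda>z. w * z" borel borel A] A by simp
  have E: "E \<in> sets borel" using measurable_sets[OF cis_borel A] by (simp add: E_def)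
  have aE: "(+) a -` E \<in> sets borel" using measurable_sets[of "(+) a" borel borel E] E by simp
  have per: "x + 2 * pi \<in> E \<longleftrightarrow> x \<in> E" for x by (simp add: E_def flip: cis_mult)
  have shift: "cis -` ((\<lambda>z. w * z) -` A) = (+) a -` E"
    by (auto simp: E_def a(1) cis_mult)
  \<comment> \<open>\<open>circle_measure\<close> is built on the closed interval, the periodicity
    argument on the half-open one; they differ by a null set.\<close>
  have endpoint: "emeasure lborel ({-pi..pi} \<inter> B) = emeasure lborel ({-pi..<pi} \<inter> B)"
    if "B \<in> sets borel" for B
  proof (rule emeasure_eq_AE)
    have "AE x in lborel. x \<noteq> pi" by (rule AE_lborel_singleton)
    then show "AE x in lborel. x \<in> {-pi..pi} \<inter> B \<longleftrightarrow> x \<in> {-pi..<pi} \<inter> B" by eventually_elim auto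
  qed (use that in auto)
  have "emeasure (distr circle_measure borel (\<lambda>z. w * z)) A = emeasure circle_measure ((\<lambda>z. w * z) -` A)"
    using A by (subst emeasure_distr) (auto intro!: measurable_circle_measureI)
  also have "\<dots> = emeasure circle_measure A"
    unfolding emeasure_circle_measure[OF wA] emeasure_circle_measure[OF A] shift
    using emeasure_lborel_periodic[OF E per a(2,3)] endpoint[OF E] endpoint[OF aE] by (simp add: E_def)
  finally show "emeasure (distr circle_measure borel (\<lambda>z. w * z)) A = emeasure circle_measure A" .
qed simp

lemma borel_measurable_circle_iff: "f \<in> borel_measurable circle_measure \<longleftrightarrow> f \<in> borel_measurable borel"
  by (simp only: measurable_cong_sets[OF sets_circle_measure refl])

lemma integral_circle_rotate:
  fixes F :: "complex \<Rightarrow> 'b::{banach, second_countable_topology}"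
  assumes "norm w = 1" and [measurable]: "F \<in> borel_measurable borel"
  shows "(LINT z|circle_measure. F (w * z)) = (LINT z|circle_measure. F z)"
    and "integrable circle_measure (\<lambda>z. F (w * z)) \<longleftrightarrow> integrable circle_measure F"
proof -
  have m: "(\<lambda>z. w * z) \<in> measurable circle_measure borel"
    by (auto intro!: measurable_circle_measureI)
  show "(LINT z|circle_measure. F (w * z)) = (LINT z|circle_measure. F z)"
    using integral_distr[OF m assms(2)] unfolding distr_circle_measure_rotate[OF assms(1)] by simp
  show "integrable circle_measure (\<lambda>z. F (w * z)) \<longleftrightarrow> integrable circle_measure F"
    using integrable_distr_eq[OF m assms(2)] unfolding distr_circle_measure_rotate[OF assms(1)] by simp
qed

lemma integral_circle_inverse:
  fixes F :: "complex \<Rightarrow> 'b::{banach, second_countable_topology}"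
  assumes [measurable]: "F \<in> borel_measurable borel"
  shows "(LINT z|circle_measure. F (1 / z)) = (LINT z|circle_measure. F z)"
    and "integrable circle_measure (\<lambda>z. F (1 / z)) \<longleftrightarrow> integrable circle_measure F"
proof -
  have m: "(\<lambda>z. 1 / z) \<in> measurable circle_measure borel"
    by (auto intro!: measurable_circle_measureI)
  have d: "distr circle_measure borel (\<lambda>z::complex. 1 / z) = circle_measure"
    by (rule distr_circle_measure_reflect) (auto simp: divide_inverse)
  show "(LINT z|circle_measure. F (1 / z)) = (LINT z|circle_measure. F z)"
    using integral_distr[OF m assms] unfolding d by simp
  show "integrable circle_measure (\<lambda>z. F (1 / z)) \<longleftrightarrow> integrable circle_measure F"
    using integrable_distr_eq[OF m assms] unfolding d by simp
qed

section \<open>Uniqueness of Fourier coefficients\<close>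

lemma integrable_circle_mult_powi:
  assumes "integrable circle_measure f"
  shows "integrable circle_measure (\<lambda>z. f z * z powi k)"
proof (rule Bochner_Integration.integrable_bound[OF assms])
  note [measurable] = powi_borel
  show "(\<lambda>z. f z * z powi k) \<in> borel_measurable circle_measure"
    using borel_measurable_integrable[OF assms] by measurable
  show "AE z in circle_measure. norm (f z * z powi k) \<le> norm (f z)"
    using AE_circle_norm by eventually_elim (simp add: norm_mult norm_power_int)
qed

text \<open>On the circle every real linear functional is a combination of \<open>z\<close> and \<open>1/z\<close>, so the
  functions with vanishing Fourier coefficients are stable under multiplication by polynomials in
  the real and imaginary parts.\<close>

lemma fourier_null_mult_polynomial:
  fixes q :: "complex \<Rightarrow> real" and f :: "complex \<Rightarrow> complex"
  assumes "real_polynomial_function q"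
    and "integrable circle_measure f" "\<And>k::int. (LINT z|circle_measure. f z * z powi k) = 0"
  shows "integrable circle_measure (\<lambda>z. f z * q z) \<and> (\<forall>k::int. (LINT z|circle_measure. f z * q z * z powi k) = 0)"
proof -
  note [measurable] = powi_borel
  show ?thesis using assms
  proof (induction arbitrary: f rule: real_polynomial_function.induct)
    case (linear l)
    note prems = linear.prems
    interpret bounded_linear l by fact
    \<comment> \<open>Solved from alpha + beta = l(1) and i (alpha - beta) = l(i).\<close>
    define \<alpha> where "\<alpha> = (of_real (l 1) - \<i> * of_real (l \<i>)) / 2"
    define \<beta> where "\<beta> = (of_real (l 1) + \<i> * of_real (l \<i>)) / 2"
    have l: "of_real (l z) = \<alpha> * z + \<beta> * cnj z" for z
    proof -
      have "z = Re z *\<^sub>R 1 + Im z *\<^sub>R \<i>" by (simp add: complex_eq_iff)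
      then have "l z = l (Re z *\<^sub>R 1 + Im z *\<^sub>R \<i>)" by (rule arg_cong)
      also have "\<dots> = Re z * l 1 + Im z * l \<i>" by (simp only: add scaleR real_scaleR_def)
      finally show ?thesis by (simp add: \<alpha>_def \<beta>_def complex_eq_iff field_simps)
    qed
    have circ: "f z * of_real (l z) * z powi k = \<alpha> * (f z * z powi (k + 1)) + \<beta> * (f z * z powi (k - 1))"
      if "norm z = 1" for z and k :: int
    proof -
      have "cnj z * z = 1" using that by (simp add: complex_norm_square[symmetric] mult.commute)
      then have z: "cnj z = inverse z" "z \<noteq> 0" by (auto intro: inverse_unique[symmetric] simp: mult.commute)
      show ?thesis unfolding l z(1) using z(2) by (simp add: power_int_add power_int_diff field_simps)
    qed
    have ae: "AE z in circle_measure. f z * of_real (l z) * z powi k = \<alpha> * (f z * z powi (k + 1)) + \<beta> * (f z * z powi (k - 1))" for k :: int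
      using AE_circle_norm by eventually_elim (rule circ)
    have [measurable]: "f \<in> borel_measurable borel"
      using borel_measurable_integrable[OF prems(1)] by (simp add: borel_measurable_circle_iff)
    have [measurable]: "l \<in> borel_measurable borel"
      by (intro borel_measurable_continuous_onI continuous_on continuous_on_id)
    have eq: "integrable circle_measure (\<lambda>z. f z * of_real (l z) * z powi k)
        \<longleftrightarrow> integrable circle_measure (\<lambda>z. \<alpha> * (f z * z powi (k + 1)) + \<beta> * (f z * z powi (k - 1)))"
       "(LINT z|circle_measure. f z * of_real (l z) * z powi k)
        = (LINT z|circle_measure. \<alpha> * (f z * z powi (k + 1)) + \<beta> * (f z * z powi (k - 1)))" for k
      by (intro integrable_cong_AE integral_cong_AE ae; measurable)+
    show ?case
      using eq(1)[of 0] eq(2) prems(2) integrable_circle_mult_powi[OF prems(1)]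
        integrable_circle_mult_powi[OF prems(1), of 1] integrable_circle_mult_powi[OF prems(1), of "-1"]
      by simp
  next
    case (const c)
    then show ?case by (simp add: mult.assoc mult.left_commute)
  next
    case (add q r)
    note q = add.IH(1)[OF add.prems] and r = add.IH(2)[OF add.prems]
    then show ?case
      using integrable_circle_mult_powi[OF conjunct1[OF q]] integrable_circle_mult_powi[OF conjunct1[OF r]]
      by (simp add: distrib_left distrib_right)
  next
    case (mult q r)
    have 1: "integrable circle_measure (\<lambda>z. f z * q z)" "\<And>k::int. (LINT z|circle_measure. f z * q z * z powi k) = 0"
      using mult.IH(1)[OF mult.prems] by auto
    \<comment> \<open>The hypothesis for r is applied to f q, which is why f is generalized in the
      induction.\<close>
    show ?case using mult.IH(2)[OF 1] by (simp add: mult.assoc)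
  qed
qed

text \<open>Stone-Weierstrass on the circle: real polynomials within 1/(n+1) of
  \<open>\<phi>\<close> have zero integral against f, so the integral for \<open>\<phi>\<close> is
  at most 1/(n+1) times the L^1 norm of f, for every n.\<close>

lemma fourier_null_integral_continuous:
  fixes \<phi> :: "complex \<Rightarrow> real" and f :: "complex \<Rightarrow> complex"
  assumes \<phi>: "continuous_on UNIV \<phi>" 
    and f: "integrable circle_measure f" "\<And>k::int. (LINT z|circle_measure. f z * z powi k) = 0"
  shows "(LINT z|circle_measure. f z * \<phi> z) = 0"
proof -
  have [measurable]: "f \<in> borel_measurable borel"
    using borel_measurable_integrable[OF f(1)] by (simp add: borel_measurable_circle_iff)
  have [measurable]: "\<phi> \<in> borel_measurable borel"
    using \<phi> by (rule borel_measurable_continuous_onI)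
  have "\<forall>n. \<exists>q. polynomial_function q \<and> (\<forall>x\<in>sphere 0 1. norm (\<phi> x - q x) < inverse (Suc n))"
    by (intro allI Stone_Weierstrass_polynomial_function) (auto intro: continuous_on_subset[OF \<phi>])
  from choice[OF this] obtain q where q': "\<And>n. polynomial_function (q n)"
      "\<And>n x. x \<in> sphere 0 1 \<Longrightarrow> norm (\<phi> x - q n x) < inverse (Suc n)" by blast
  have q: "real_polynomial_function (q n)" "norm x = 1 \<Longrightarrow> \<bar>\<phi> x - q n x\<bar> < inverse (Suc n)" for n x
    using q'(1)[of n] q'(2)[of x n] by (simp_all add: real_polynomial_function_eq)
  have zero: "(LINT z|circle_measure. f z * q n z) = 0" for n
    using fourier_null_mult_polynomial[OF q(1) f] by (metis (no_types, lifting) Bochner_Integration.integral_cong mult.right_neutral power_int_0_right)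
  have qm [measurable]: "q n \<in> borel_measurable borel" for n
    using q(1) by (intro borel_measurable_continuous_onI continuous_on_polymonial_function) (simp add: real_polynomial_function_eq)
  have qint: "integrable circle_measure (\<lambda>z. f z * q n z)" for n
    using fourier_null_mult_polynomial[OF q(1) f] by blast
  have dint: "integrable circle_measure (\<lambda>z. f z * (\<phi> z - q n z))" for n
  proof (rule Bochner_Integration.integrable_bound[OF f(1)])
    show "AE z in circle_measure. norm (f z * (\<phi> z - q n z)) \<le> norm (f z)"
      using AE_circle_norm
    proof eventually_elim
      fix z :: complex assume "norm z = 1"
      then have "\<bar>\<phi> z - q n z\<bar> < inverse (Suc n)" by (rule q(2))
      also have "\<dots> \<le> 1" by (simp add: field_simps)
      finally have "norm (of_real (\<phi> z) - of_real (q n z) :: complex) \<le> 1" by (simp flip: of_real_diff)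
      then show "norm (f z * (\<phi> z - q n z)) \<le> norm (f z)" by (simp add: norm_mult mult_left_le)
    qed
  qed measurable
  have bound: "norm (LINT z|circle_measure. f z * \<phi> z) \<le> inverse (Suc n) * (LINT z|circle_measure. norm (f z))" for n
  proof -
    have "(LINT z|circle_measure. f z * \<phi> z) = (LINT z|circle_measure. f z * (\<phi> z - q n z) + f z * q n z)"
      by (simp add: algebra_simps)
    also have "\<dots> = (LINT z|circle_measure. f z * (\<phi> z - q n z))"
      using zero[of n] dint qint by (subst Bochner_Integration.integral_add) auto
    also have "norm \<dots> \<le> (LINT z|circle_measure. norm (f z * (\<phi> z - q n z)))" by (rule integral_norm_bound)
    also have "\<dots> \<le> (LINT z|circle_measure. inverse (Suc n) * norm (f z))"
    proof (rule integral_mono_AE)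
      show "AE z in circle_measure. norm (f z * (\<phi> z - q n z)) \<le> inverse (Suc n) * norm (f z)"
        using AE_circle_norm
      proof eventually_elim
        fix z :: complex assume "norm z = 1"
        then have "\<bar>\<phi> z - q n z\<bar> \<le> inverse (Suc n)" using q(2) by (simp add: less_imp_le)
        then have "norm (of_real (\<phi> z) - of_real (q n z) :: complex) \<le> inverse (Suc n)" by (simp flip: of_real_diff)
        then show "norm (f z * (\<phi> z - q n z)) \<le> inverse (Suc n) * norm (f z)"
          by (simp add: norm_mult mult_left_mono mult.commute[of _ "norm (f z)"])
      qed
    qed (use f dint in auto)
    finally show ?thesis using f by simp
  qed
  have "(\<lambda>n. inverse (Suc n) * (LINT z|circle_measure. norm (f z))) \<longlonglongrightarrow> 0 * (LINT z|circle_measure. norm (f z))"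
    by (intro tendsto_intros LIMSEQ_inverse_real_of_nat)
  then have "norm (LINT z|circle_measure. f z * \<phi> z) \<le> 0"
    using bound by (intro LIMSEQ_le_const) auto
  then show ?thesis by simp
qed

text \<open>The function max(0, 1 - n dist(z, K)) is 1 on K and eventually 0 at each z outside,
  since such a z has positive distance from a closed set.\<close>

lemma closed_indicator_limit:
  fixes K :: "'a::metric_space set"
  assumes "closed K"
  obtains \<psi> :: "nat \<Rightarrow> 'a \<Rightarrow> real" where "\<And>n. continuous_on UNIV (\<psi> n)" "\<And>n z. \<bar>\<psi> n z\<bar> \<le> 1"
    "\<And>z. (\<lambda>n. \<psi> n z) \<longlonglongrightarrow> indicator K z"
\<comment> \<open>\<open>infdist z {}\<close> is 0 by convention, so for empty K the formula below
  would give the constant 1.\<close>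
proof (cases "K = {}")
  case True
  then show ?thesis using that[of "\<lambda>_ _. 0"] by simp
next
  case False
  define \<psi> where "\<psi> n z = max 0 (1 - real n * infdist z K)" for n z
  have "(\<lambda>n. \<psi> n z) \<longlonglongrightarrow> indicator K z" for z
  proof (cases "z \<in> K")
    case True then show ?thesis by (simp add: \<psi>_def)
  next
    case nK: False
    then have pos: "infdist z K > 0"
      using assms False infdist_nonneg[of z K] in_closed_iff_infdist_zero[of K z] by auto
    obtain N where N: "1 < real N * infdist z K" using reals_Archimedean3[OF pos] by blast
    have "\<psi> n z = 0" if "n \<ge> N" for n
    proof -
      have "real N * infdist z K \<le> real n * infdist z K" using that pos by simp
      with N show ?thesis by (simp add: \<psi>_def)
    qed
    then have "eventually (\<lambda>n. \<psi> n z = indicator K z) sequentially"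
      using nK by (auto simp: eventually_sequentially)
    then show ?thesis by (rule tendsto_eventually)
  qed
  moreover have "\<bar>\<psi> n z\<bar> \<le> 1" for n z by (auto simp: \<psi>_def infdist_nonneg)
  moreover have "continuous_on UNIV (\<psi> n)" for n
    unfolding \<psi>_def by (intro continuous_intros)
  ultimately show ?thesis using that[of \<psi>] by blast
qed

text \<open>Continuous test functions approximate indicators of closed sets, and a Dynkin class
  argument reaches all Borel sets. Thus f has integral 0 over every Borel set.\<close>

lemma circle_fourier_unique:
  fixes f :: "complex \<Rightarrow> complex"
  assumes f: "integrable circle_measure f" "\<And>k::int. (LINT z|circle_measure. f z * z powi k) = 0"
  shows "AE z in circle_measure. f z = 0"
proof -
  have [measurable]: "f \<in> borel_measurable borel"
    using borel_measurable_integrable[OF f(1)] by (simp add: borel_measurable_circle_iff)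
  have ind: "integrable circle_measure (\<lambda>z. f z * indicator A z)" if "A \<in> sets borel" for A
    using integrable_mult_indicator[OF _ f(1), of A] that by (simp add: scaleR_conv_of_real mult.commute of_real_indicator)
  have closed0: "(LINT z|circle_measure. f z * indicator K z) = 0" if K: "closed K" for K
  proof -
    obtain \<psi> :: "nat \<Rightarrow> complex \<Rightarrow> real" where \<psi>: "\<And>n. continuous_on UNIV (\<psi> n)" "\<And>n z. \<bar>\<psi> n z\<bar> \<le> 1"
      "\<And>z. (\<lambda>n. \<psi> n z) \<longlonglongrightarrow> indicator K z"
      using closed_indicator_limit[OF K] by blast
    have [measurable]: "\<psi> n \<in> borel_measurable borel" for n
      using \<psi>(1) by (rule borel_measurable_continuous_onI)
    have [measurable]: "K \<in> sets borel" using that by auto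
    have \<psi>_lim: "(\<lambda>n. of_real (\<psi> n z)) \<longlonglongrightarrow> (indicator K z :: complex)" for z
      using tendsto_of_real[OF \<psi>(3)[of z]] by (simp only: of_real_indicator)
    have "(\<lambda>n. LINT z|circle_measure. f z * \<psi> n z) \<longlonglongrightarrow> (LINT z|circle_measure. f z * indicator K z)"
    proof (rule integral_dominated_convergence[where w = "\<lambda>z. norm (f z)"])
      show "AE z in circle_measure. (\<lambda>n. f z * \<psi> n z) \<longlonglongrightarrow> f z * indicator K z"
        by (intro AE_I2 tendsto_mult tendsto_const \<psi>_lim)
      show "AE z in circle_measure. norm (f z * \<psi> n z) \<le> norm (f z)" for n
        using \<psi>(2) by (intro AE_I2) (simp add: norm_mult mult_left_le)
    qed (use f in auto)
    moreover have "(LINT z|circle_measure. f z * \<psi> n z) = 0" for n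
      by (rule fourier_null_integral_continuous[OF \<psi>(1) f])
    ultimately show ?thesis by (simp add: LIMSEQ_const_iff)
  qed
  have borel0: "(LINT z|circle_measure. f z * indicator A z) = 0" if "A \<in> sets borel" for A
  proof -
    have sig: "sigma_sets UNIV (Collect closed) = sets (borel :: complex measure)"
      by (simp add: borel_eq_closed)
    have "Int_stable (Collect closed :: complex set set)" by (auto simp: Int_stable_def)
    moreover have "Collect closed \<subseteq> Pow (UNIV :: complex set)" by simp
    moreover from that have "A \<in> sigma_sets UNIV (Collect closed)" by (simp add: sig)
    ultimately show ?thesis
    proof (induction rule: sigma_sets_induct_disjoint)
      case (basic A)
      then show ?case by (simp add: closed0)
    next
      case empty
      show ?case by simp
    next
      case (compl A)
      then have A: "A \<in> sets borel" by (simp add: sig)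
      have "(LINT z|circle_measure. f z * indicator (UNIV - A) z)
          = (LINT z|circle_measure. f z * indicator UNIV z - f z * indicator A z)"
        by (intro Bochner_Integration.integral_cong) (auto simp: indicator_def)
      also have "\<dots> = 0"
        using compl closed0[of UNIV] ind[OF A] f(1) by (subst Bochner_Integration.integral_diff) auto
      finally show ?case .
    next
      case (union A)
      then have A [measurable]: "A i \<in> sets borel" for i by (auto simp: sig)
      have swap: "(LINT z|circle_measure. f z * indicator B z) = (LINT z:B|circle_measure. f z)" for B
        unfolding set_lebesgue_integral_def by (simp add: scaleR_conv_of_real of_real_indicator mult.commute)
      have "(LINT z:(\<Union>i. A i)|circle_measure. f z) = (\<Sum>i. LINT z:A i|circle_measure. f z)"
      proof (rule lebesgue_integral_countable_add)
        show "set_integrable circle_measure (\<Union>i. A i) f"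
          unfolding set_integrable_def by (rule integrable_mult_indicator) (use f in auto)
      qed (use union(1) in \<open>auto simp: disjoint_family_on_def\<close>)
      then show ?case using union(3) by (simp add: swap)
    qed
  qed
  \<comment> \<open>A real density is determined almost everywhere by its integrals over sets, so
    real and imaginary parts are treated apart.\<close>
  have Re: "AE z in circle_measure. Re (f z) = 0"
  proof (rule density_unique_real)
    fix A assume "A \<in> sets circle_measure"
    then have A: "A \<in> sets borel" by simp
    have "(LINT z:A|circle_measure. Re (f z)) = (LINT z|circle_measure. Re (f z * indicator A z))"
      unfolding set_lebesgue_integral_def by (intro Bochner_Integration.integral_cong) (auto simp: indicator_def)
    also have "\<dots> = Re (LINT z|circle_measure. f z * indicator A z)"
      by (rule integral_Re[OF ind[OF A]])
    finally show "(LINT z:A|circle_measure. Re (f z)) = (LINT z:A|circle_measure. 0)"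
      using borel0[OF A] by simp
  qed (use f in simp_all)
  have Im: "AE z in circle_measure. Im (f z) = 0"
  proof (rule density_unique_real)
    fix A assume "A \<in> sets circle_measure"
    then have A: "A \<in> sets borel" by simp
    have "(LINT z:A|circle_measure. Im (f z)) = (LINT z|circle_measure. Im (f z * indicator A z))"
      unfolding set_lebesgue_integral_def by (intro Bochner_Integration.integral_cong) (auto simp: indicator_def)
    also have "\<dots> = Im (LINT z|circle_measure. f z * indicator A z)"
      by (rule integral_Im[OF ind[OF A]])
    finally show "(LINT z:A|circle_measure. Im (f z)) = (LINT z:A|circle_measure. 0)"
      using borel0[OF A] by simp
  qed (use f in simp_all)
  show ?thesis using Re Im by eventually_elim (simp add: complex_eq_iff)
qed

section \<open>Products of functions in Hardy spaces\<close>

lemma circle_dense_continuous: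
  fixes h :: "complex \<Rightarrow> complex"
  assumes "integrable circle_measure h" "0 < e"
  shows "\<exists>\<phi>. continuous_on UNIV \<phi> \<and> integrable circle_measure \<phi> \<and> (LINT z|circle_measure. norm (h z - \<phi> z)) < e"
  using assms
proof (induction arbitrary: e rule: integrable_induct)
  case (base A c)
  \<comment> \<open>Two errors of e' are incurred, from A to K and from K to a continuous function;
    the summand 1 keeps the denominator positive for c = 0.\<close>
  define e' where "e' = e / (2 * (norm c + 1))"
  have e': "0 < e'" using base(3) by (auto simp: e'_def intro!: divide_pos_pos add_nonneg_pos)
  have A [measurable]: "A \<in> sets borel" using base(1) by simp
  obtain K where K: "compact K" "K \<subseteq> A" "measure circle_measure A - e' < measure circle_measure K"
  \<comment> \<open>If A is this small, the difference to be compared in \<open>ennreal\<close>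
    would be negative and truncated to 0; the empty set serves instead.\<close>
  proof (cases "measure circle_measure A < e'")
    case True
    then show ?thesis using that[of "{}"] by simp
  next
    case False
    then have "ennreal (measure circle_measure A - e') < ennreal (measure circle_measure A)"
      using e' by (intro ennreal_lessI) auto
    also have "\<dots> = (SUP K \<in> {K. K \<subseteq> A \<and> compact K}. emeasure circle_measure K)"
      unfolding circle_measure.emeasure_eq_measure[symmetric]
      by (rule inner_regular) (use A in auto)
    finally obtain K where K: "K \<subseteq> A" "compact K" "ennreal (measure circle_measure A - e') < emeasure circle_measure K"
      by (auto simp: less_SUP_iff)
    from K(3) have "measure circle_measure A - e' < measure circle_measure K"
      using False by (simp add: circle_measure.emeasure_eq_measure ennreal_less_iff)
    with that K show ?thesis by blast
  qed
  have K' [measurable]: "K \<in> sets borel" using K(1) by (simp add: borel_compact)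
  obtain \<psi> :: "nat \<Rightarrow> complex \<Rightarrow> real" where \<psi>: "\<And>n. continuous_on UNIV (\<psi> n)" "\<And>n z. \<bar>\<psi> n z\<bar> \<le> 1"
      "\<And>z. (\<lambda>n. \<psi> n z) \<longlonglongrightarrow> indicator K z"
    using closed_indicator_limit[OF compact_imp_closed[OF K(1)]] by blast
  have [measurable]: "\<psi> n \<in> borel_measurable borel" for n
    using \<psi>(1) by (rule borel_measurable_continuous_onI)
  have \<psi>_int: "integrable circle_measure (\<psi> n)" for n
    by (rule circle_measure.integrable_const_bound[of _ 1]) (use \<psi>(2) in auto)
  have ind_int: "integrable circle_measure (indicator B :: complex \<Rightarrow> real)" if "B \<in> sets borel" for B
    using that by (simp add: circle_measure.emeasure_eq_measure)
  have lim: "(\<lambda>n. LINT z|circle_measure. \<bar>indicator K z - \<psi> n z\<bar>) \<longlonglongrightarrow> (LINT z|circle_measure. (0::real))"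
  proof (rule integral_dominated_convergence[where w = "\<lambda>_. 2"])
    have "(\<lambda>n. \<bar>indicator K z - \<psi> n z\<bar>) \<longlonglongrightarrow> \<bar>indicator K z - indicator K z :: real\<bar>" for z
      by (intro tendsto_intros \<psi>(3))
    then show "AE z in circle_measure. (\<lambda>n. \<bar>indicator K z - \<psi> n z\<bar>) \<longlonglongrightarrow> 0" by simp
    show "AE z in circle_measure. norm \<bar>indicator K z - \<psi> n z\<bar> \<le> 2" for n
    proof (intro AE_I2)
      fix z
      show "norm \<bar>indicator K z - \<psi> n z\<bar> \<le> 2" using \<psi>(2)[of n z] by (auto simp: indicator_def)
    qed
  qed auto
  have "eventually (\<lambda>n. (LINT z|circle_measure. \<bar>indicator K z - \<psi> n z\<bar>) < e') sequentially"
    using order_tendstoD(2)[OF lim] e' by simp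
  then obtain n where n: "(LINT z|circle_measure. \<bar>indicator K z - \<psi> n z\<bar>) < e'"
    by (auto simp: eventually_sequentially)
  have "(LINT z|circle_measure. \<bar>indicator A z - indicator K z\<bar>) = (LINT z|circle_measure. indicator A z - indicator K z :: real)"
    using K(2) by (intro Bochner_Integration.integral_cong) (auto simp: indicator_def)
  also have "\<dots> = measure circle_measure A - measure circle_measure K"
    using ind_int[OF A] ind_int[OF K'] by simp
  finally have AK: "(LINT z|circle_measure. \<bar>indicator A z - indicator K z :: real\<bar>) < e'" using K(3) by simp
  have "(LINT z|circle_measure. norm (indicat_real A z *\<^sub>R c - \<psi> n z *\<^sub>R c))
     \<le> (LINT z|circle_measure. norm c * (\<bar>indicator A z - indicator K z\<bar> + \<bar>indicator K z - \<psi> n z\<bar>))"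
  proof (rule integral_mono)
    show "norm (indicat_real A z *\<^sub>R c - \<psi> n z *\<^sub>R c) \<le> norm c * (\<bar>indicator A z - indicator K z\<bar> + \<bar>indicator K z - \<psi> n z\<bar>)" for z
      by (simp add: scaleR_diff_left[symmetric] mult.commute mult_left_mono)
  qed (use ind_int[OF A] ind_int[OF K'] \<psi>_int[of n] in auto)
  also have "\<dots> = norm c * ((LINT z|circle_measure. \<bar>indicat_real A z - indicator K z\<bar>) + (LINT z|circle_measure. \<bar>indicator K z - \<psi> n z\<bar>))"
    using ind_int[OF A] ind_int[OF K'] \<psi>_int[of n] by simp
  also have "\<dots> \<le> norm c * (e' + e')" using AK n by (intro mult_left_mono add_mono) auto
  also have "\<dots> < (norm c + 1) * (e' + e')" using e' by (intro mult_strict_right_mono) auto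
  also have "\<dots> = e" by (simp add: e'_def field_simps add_nonneg_eq_0_iff)
  finally show ?case using \<psi>(1) \<psi>_int
    by (intro exI[of _ "\<lambda>z. \<psi> n z *\<^sub>R c"]) (auto intro!: continuous_intros)
next
  case (add f g)
  from add(3)[of "e/2"] add(4)[of "e/2"] add(5) obtain \<phi> \<psi> where *:
    "continuous_on UNIV \<phi>" "integrable circle_measure \<phi>" "(LINT z|circle_measure. norm (f z - \<phi> z)) < e/2"
    "continuous_on UNIV \<psi>" "integrable circle_measure \<psi>" "(LINT z|circle_measure. norm (g z - \<psi> z)) < e/2"
    by auto
  have "(LINT z|circle_measure. norm (f z + g z - (\<phi> z + \<psi> z)))
     \<le> (LINT z|circle_measure. norm (f z - \<phi> z) + norm (g z - \<psi> z))"
    by (intro integral_mono) (use * add(1,2) in \<open>auto simp: norm_diff_triangle_ineq\<close>)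
  also have "\<dots> < e" using * add(1,2) by simp
  finally show ?case using *
    by (intro exI[of _ "\<lambda>z. \<phi> z + \<psi> z"]) (auto intro!: continuous_intros)
next
  case (lim f s)
  have "(\<lambda>i. LINT z|circle_measure. norm (f z - s i z)) \<longlonglongrightarrow> (LINT z|circle_measure. (0::real))"
  \<comment> \<open>\<open>integrable_induct\<close> provides |s_i| <= 2 |f|, hence the bound 3 |f|
    for the difference.\<close>
  proof (rule integral_dominated_convergence[where w = "\<lambda>z. 3 * norm (f z)"])
    have "(\<lambda>i. norm (f z - s i z)) \<longlonglongrightarrow> norm (f z - f z)" for z
      using lim(2)[of z] by (intro tendsto_intros) auto
    then show "AE z in circle_measure. (\<lambda>i. norm (f z - s i z)) \<longlonglongrightarrow> 0" by simp
    show "AE z in circle_measure. norm (norm (f z - s i z)) \<le> 3 * norm (f z)" for i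
    proof (intro AE_I2)
      fix z
      show "norm (norm (f z - s i z)) \<le> 3 * norm (f z)"
        using lim(3)[of z i] norm_triangle_ineq4[of "f z" "s i z"] by simp
    qed
  qed (use lim in auto)
  then have "eventually (\<lambda>i. (LINT z|circle_measure. norm (f z - s i z)) < e/2) sequentially"
    using lim(6) by (intro order_tendstoD(2)) auto
  then obtain i where i: "(LINT z|circle_measure. norm (f z - s i z)) < e/2" by (auto simp: eventually_sequentially)
  obtain \<phi> where *: "continuous_on UNIV \<phi>" "integrable circle_measure \<phi>" "(LINT z|circle_measure. norm (s i z - \<phi> z)) < e/2"
    using lim(5)[of "e/2" i] lim(6) by auto
  have "(LINT z|circle_measure. norm (f z - \<phi> z))
     \<le> (LINT z|circle_measure. norm (f z - s i z) + norm (s i z - \<phi> z))"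
  proof (rule integral_mono)
    show "norm (f z - \<phi> z) \<le> norm (f z - s i z) + norm (s i z - \<phi> z)" for z
      using norm_triangle_ineq[of "f z - s i z" "s i z - \<phi> z"] by simp
  qed (use * lim(1,4) in auto)
  also have "\<dots> < e" using * i lim(1,4) by simp
  finally show ?case using * by blast
qed

text \<open>Compare h with a continuous \<open>\<phi>\<close>: the latter moves little by uniform
  continuity on the compact circle, and rotation invariance keeps the error of the approximation the
  same after the rotation.\<close>

lemma circle_rotation_continuous:
  fixes h :: "complex \<Rightarrow> complex"
  assumes h: "integrable circle_measure h" and e: "0 < e"
  obtains d where "0 < d" "\<And>w. norm w = 1 \<Longrightarrow> norm (w - 1) < d \<Longrightarrow> (LINT z|circle_measure. norm (h (w * z) - h z)) < e"
proof -
  have h_m [measurable]: "h \<in> borel_measurable borel"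
    using borel_measurable_integrable[OF h] by (simp add: borel_measurable_circle_iff)
  obtain \<phi> where \<phi>: "continuous_on UNIV \<phi>" "integrable circle_measure \<phi>" "(LINT z|circle_measure. norm (h z - \<phi> z)) < e/4"
    using circle_dense_continuous[OF h, of "e/4"] e by auto
  have [measurable]: "\<phi> \<in> borel_measurable borel" using \<phi>(1) by (rule borel_measurable_continuous_onI)
  have "uniformly_continuous_on (sphere 0 1) \<phi>"
    by (rule compact_uniformly_continuous) (auto intro: continuous_on_subset[OF \<phi>(1)])
  then obtain d where d: "0 < d" "\<And>x y. norm x = 1 \<Longrightarrow> norm y = 1 \<Longrightarrow> dist x y < d \<Longrightarrow> dist (\<phi> x) (\<phi> y) < e/4"
    unfolding uniformly_continuous_on_def using e by (metis divide_pos_pos mem_sphere_0 zero_less_numeral)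
  show ?thesis
  proof (rule that[OF d(1)])
    fix w :: complex assume w: "norm w = 1" "norm (w - 1) < d"
    have int: "integrable circle_measure (\<lambda>z. norm (h z - \<phi> z))" using h \<phi> by auto
    have rot: "(LINT z|circle_measure. norm (h (w * z) - \<phi> (w * z))) = (LINT z|circle_measure. norm (h z - \<phi> z))"
      "integrable circle_measure (\<lambda>z. norm (h (w * z) - \<phi> (w * z)))"
      using integral_circle_rotate[OF w(1), of "\<lambda>z. norm (h z - \<phi> z)"] int by simp_all
    have hw: "integrable circle_measure (\<lambda>z. h (w * z))"
      using integral_circle_rotate(2)[OF w(1) h_m] h by simp
    have "(LINT z|circle_measure. norm (h (w * z) - h z)) 
      \<le> (LINT z|circle_measure. norm (h (w * z) - \<phi> (w * z)) + norm (h z - \<phi> z) + e/4)"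
    proof (rule integral_mono_AE)
      show "AE z in circle_measure. norm (h (w * z) - h z) \<le> norm (h (w * z) - \<phi> (w * z)) + norm (h z - \<phi> z) + e/4"
        using AE_circle_norm
      proof eventually_elim
        fix z :: complex assume z: "norm z = 1"
        have "w * z - z = (w - 1) * z" by (simp add: algebra_simps)
        then have "dist (w * z) z = norm (w - 1)" using z by (simp add: dist_norm norm_mult)
        then have "dist (\<phi> (w * z)) (\<phi> z) < e/4" using d(2)[of "w * z" z] w z by (simp add: norm_mult)
        moreover have "norm (h (w * z) - h z) \<le> norm (h (w * z) - \<phi> (w * z)) + norm (\<phi> (w * z) - \<phi> z) + norm (\<phi> z - h z)"
          using norm_triangle_ineq[of "h (w * z) - \<phi> (w * z)" "\<phi> (w * z) - \<phi> z"]
            norm_triangle_ineq[of "h (w * z) - \<phi> z" "\<phi> z - h z"] by simp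
        ultimately show "norm (h (w * z) - h z) \<le> norm (h (w * z) - \<phi> (w * z)) + norm (h z - \<phi> z) + e/4"
          by (simp add: dist_norm norm_minus_commute)
      qed
    qed (use h hw int rot(2) in auto)
    also have "\<dots> = (LINT z|circle_measure. norm (h z - \<phi> z)) + (LINT z|circle_measure. norm (h z - \<phi> z)) + e/4 * measure circle_measure UNIV"
      using int rot by simp
    also have "\<dots> < e/4 + e/4 + e/4 + e/4"
      using \<phi>(3) e by (intro add_less_le_mono add_strict_mono) (auto simp: measure_def prob_circle_measure)
    finally show "(LINT z|circle_measure. norm (h (w * z) - h z)) < e" by simp
  qed
qed

section \<open>Fourier coefficients of correlations\<close>

lemma integral_circle_powi:
  fixes m :: int
  assumes "m \<noteq> 0"
  shows "(LINT z|circle_measure. z powi m) = 0"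
proof -
  \<comment> \<open>This rotation multiplies z^m by -1, so the integral equals its own
    negative.\<close>
  define w where "w = cis (pi / m)"
  have w: "norm w = 1" "w powi m = -1" using assms by (simp_all add: w_def cis_power_int)
  have "(LINT z|circle_measure. z powi m) = (LINT z|circle_measure. (w * z) powi m)"
    using integral_circle_rotate(1)[OF w(1) powi_borel[of m]] by simp
  also have "\<dots> = - (LINT z|circle_measure. z powi m)"
    using w(2) by (simp add: power_int_mult_distrib)
  finally show ?thesis by simp
qed

text \<open>Fubini, and for fixed t the rotation w -> t w, with w^m = t^(-m) (t w)^m. A correlation
  is taken and not a convolution: opposite frequencies of f and h get multiplied, so for two
  analytic functions only frequency 0 can survive.\<close>

lemma circle_correlation:
  fixes f h :: "complex \<Rightarrow> complex"
  assumes f: "integrable circle_measure f" and h: "integrable circle_measure h"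
  shows "integrable circle_measure (\<lambda>w. LINT t|circle_measure. f t * h (t * w))"
    and "(LINT w|circle_measure. (LINT t|circle_measure. f t * h (t * w)) * w powi m)
       = (LINT t|circle_measure. f t * t powi (- m)) * (LINT w|circle_measure. h w * w powi m)"
proof -
  interpret pair_sigma_finite circle_measure circle_measure ..
  note [measurable] = powi_borel
  have [measurable]: "f \<in> borel_measurable borel" "h \<in> borel_measurable borel"
    using borel_measurable_integrable[OF f] borel_measurable_integrable[OF h]
    by (simp_all add: borel_measurable_circle_iff)
  \<comment> \<open>The exponent k = 0 serves the integrability claim, k = m the formula.\<close>
  define G where "G k = (\<lambda>(t, w). f t * h (t * w) * w powi k)" for k :: int
  have Gm: "G k \<in> borel_measurable (circle_measure \<Otimes>\<^sub>M circle_measure)" for k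
    unfolding G_def by measurable
  have h_rot: "integrable circle_measure (\<lambda>w. h (t * w))" if "norm t = 1" for t
    using integral_circle_rotate(2)[OF that, of h] h by simp
  have G_int: "integrable (circle_measure \<Otimes>\<^sub>M circle_measure) (G k)" for k
  proof (rule Fubini_integrable[OF Gm])
    have "AE t in circle_measure. norm (f t) * (LINT w|circle_measure. norm (h w)) = (LINT w|circle_measure. norm (G k (t, w)))"
      using AE_circle_norm
    proof eventually_elim
      fix t :: complex assume t: "norm t = 1"
      have "(LINT w|circle_measure. norm (G k (t, w))) = (LINT w|circle_measure. norm (f t) * norm (h (t * w)))"
      proof (rule integral_cong_AE)
        show "AE w in circle_measure. norm (G k (t, w)) = norm (f t) * norm (h (t * w))"
          using AE_circle_norm by eventually_elim (simp add: G_def norm_mult norm_power_int)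
      qed (simp_all only: G_def prod.case, measurable)
      then show "norm (f t) * (LINT w|circle_measure. norm (h w)) = (LINT w|circle_measure. norm (G k (t, w)))"
        using integral_circle_rotate(1)[OF t, of "\<lambda>z. norm (h z)"] by simp
    qed
    moreover have "integrable circle_measure (\<lambda>t. norm (f t) * (LINT w|circle_measure. norm (h w)))"
      using f by simp
    moreover have "(\<lambda>t. LINT w|circle_measure. norm (G k (t, w))) \<in> borel_measurable circle_measure"
      using Gm[of k] by measurable
    ultimately show "integrable circle_measure (\<lambda>t. LINT w|circle_measure. norm (G k (t, w)))"
      using integrable_cong_AE_imp by blast
    show "AE t in circle_measure. integrable circle_measure (\<lambda>w. G k (t, w))"
      using AE_circle_norm
    proof eventually_elim
      fix t :: complex assume t: "norm t = 1"
      show "integrable circle_measure (\<lambda>w. G k (t, w))"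
        using integrable_circle_mult_powi[OF h_rot[OF t], of k] by (simp add: G_def mult.assoc)
    qed
  qed
  show "integrable circle_measure (\<lambda>w. LINT t|circle_measure. f t * h (t * w))"
    using integrable_snd[of "\<lambda>t w. G 0 (t, w)"] G_int[of 0] by (simp add: G_def)
  have "(LINT w|circle_measure. (LINT t|circle_measure. f t * h (t * w)) * w powi m)
    = (LINT w|circle_measure. (LINT t|circle_measure. G m (t, w)))"
    by (simp add: G_def)
  also have "\<dots> = (LINT t|circle_measure. (LINT w|circle_measure. G m (t, w)))"
    using Fubini_integral[of "\<lambda>t w. G m (t, w)"] G_int[of m] by simp
  also have "\<dots> = (LINT t|circle_measure. f t * t powi (- m) * (LINT w|circle_measure. h w * w powi m))"
  proof (rule integral_cong_AE)
    show "AE t in circle_measure. (LINT w|circle_measure. G m (t, w)) = f t * t powi (- m) * (LINT w|circle_measure. h w * w powi m)"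
      using AE_circle_norm
    proof eventually_elim
      fix t :: complex assume t: "norm t = 1"
      then have t0: "t \<noteq> 0" by auto
      have "(LINT w|circle_measure. G m (t, w)) = (LINT w|circle_measure. f t * t powi (- m) * (h (t * w) * (t * w) powi m))"
        using t0 by (intro Bochner_Integration.integral_cong) (simp_all add: G_def power_int_mult_distrib power_int_minus)
      also have "\<dots> = f t * t powi (- m) * (LINT w|circle_measure. h w * w powi m)"
        using integral_circle_rotate(1)[OF t, of "\<lambda>z. h z * z powi m"] by simp
      finally show "(LINT w|circle_measure. G m (t, w)) = f t * t powi (- m) * (LINT w|circle_measure. h w * w powi m)" .
    qed
    show "(\<lambda>t. LINT w|circle_measure. G m (t, w)) \<in> borel_measurable circle_measure"
      using Gm[of m] by measurable
  qed measurable
  also have "\<dots> = (LINT t|circle_measure. f t * t powi (- m)) * (LINT w|circle_measure. h w * w powi m)"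
    by simp
  finally show "(LINT w|circle_measure. (LINT t|circle_measure. f t * h (t * w)) * w powi m)
       = (LINT t|circle_measure. f t * t powi (- m)) * (LINT w|circle_measure. h w * w powi m)" .
qed

text \<open>Every arc around 1 has positive measure and hence meets any set of full measure. This
  links an almost everywhere identity with continuity at 1.\<close>

lemma AE_circle_near_one:
  assumes P: "AE w in circle_measure. P w" and d: "0 < d"
  obtains w where "norm w = 1" "norm (w - 1) < d" "P w"
proof (rule ccontr)
  assume contra: "\<not> thesis"
  have "AE w in circle_measure. w \<notin> ball 1 d"
    using P AE_circle_norm
  proof eventually_elim
    fix w assume "P w" "norm w = 1"
    then show "w \<notin> ball 1 d" using that[of w] contra by (auto simp: dist_norm norm_minus_commute)
  qed
  then have "emeasure circle_measure (ball 1 d) = 0"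
    by (subst (asm) AE_iff_measurable[of "ball 1 d"]) auto
  then have zero: "emeasure lborel ({-pi..pi} \<inter> cis -` ball 1 d) = 0"
    by (subst (asm) emeasure_circle_measure) (auto simp: ennreal_divide_eq_0_iff)
  have "continuous_on UNIV cis" by (intro continuous_intros)
  then have "isCont cis 0" by (simp add: continuous_on_eq_continuous_at)
  then obtain r where r: "0 < r" "\<And>x. \<bar>x\<bar> < r \<Longrightarrow> dist (cis x) 1 < d"
    using d unfolding continuous_at_eps_delta by (auto simp: dist_real_def)
  \<comment> \<open>The bound r/2 keeps the arc inside the neighbourhood given by continuity, the
    bound pi inside the parameter interval.\<close>
  have sub: "{0..min (r/2) pi} \<subseteq> {-pi..pi} \<inter> cis -` ball 1 d"
  proof
    fix x assume "x \<in> {0..min (r/2) pi}"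
    then have "\<bar>x\<bar> < r" "x \<in> {-pi..pi}" using r(1) by auto
    with r(2) show "x \<in> {-pi..pi} \<inter> cis -` ball 1 d" by (simp add: dist_commute)
  qed
  have "cis -` ball 1 d \<in> sets borel" using measurable_sets[OF cis_borel, of "ball 1 d"] by simp
  then have "emeasure lborel {0..min (r/2) pi} \<le> emeasure lborel ({-pi..pi} \<inter> cis -` ball 1 d)"
    using sub by (intro emeasure_mono) auto
  then show False using zero r(1) by (simp add: min_def split: if_splits)
qed

section \<open>Pairings of L^p with L^q and their continuity under rotation\<close>

lemma integrable_circle_mult:
  fixes F h :: "complex \<Rightarrow> complex"
  assumes [measurable]: "F \<in> borel_measurable borel" "h \<in> borel_measurable borel"
    and pq: "1 < p" "1 < q" "1 / p + 1 / q = 1"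
    and F: "integrable circle_measure (\<lambda>z. norm (F z) powr p)"
    and h: "integrable circle_measure (\<lambda>z. norm (h z) powr q)"
  shows "integrable circle_measure (\<lambda>z. F z * h z)"
proof (rule Bochner_Integration.integrable_bound)
  show "integrable circle_measure (\<lambda>z. norm (F z) powr p / p + norm (h z) powr q / q)"
    using F h by auto
  show "AE z in circle_measure. norm (F z * h z) \<le> norm (norm (F z) powr p / p + norm (h z) powr q / q)"
  proof (intro AE_I2)
    fix z
    show "norm (F z * h z) \<le> norm (norm (F z) powr p / p + norm (h z) powr q / q)"
      using Youngs_inequality[OF pq, of "norm (F z)" "norm (h z)"] by (simp add: norm_mult)
  qed
qed measurable

lemma integrable_circle_powr:
  fixes F :: "complex \<Rightarrow> complex"
  assumes [measurable]: "F \<in> borel_measurable borel" and p: "1 \<le> p"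
    and F: "integrable circle_measure (\<lambda>z. norm (F z) powr p)"
  shows "integrable circle_measure F"
proof (rule Bochner_Integration.integrable_bound)
  show "integrable circle_measure (\<lambda>z. 1 + norm (F z) powr p)"
    using F by auto
  show "AE z in circle_measure. norm (F z) \<le> norm (1 + norm (F z) powr p)"
  proof (intro AE_I2)
    fix z
    have "norm (F z) \<le> 1 + norm (F z) powr p"
    proof (cases "norm (F z) \<le> 1")
      case True
      then show ?thesis by (simp add: add_increasing2)
    next
      case False
      then have "norm (F z) powr 1 \<le> norm (F z) powr p" using p by (intro powr_mono) auto
      with False show ?thesis by simp
    qed
    then show "norm (F z) \<le> norm (1 + norm (F z) powr p)" by simp
  qed
qed measurable

lemma circle_tail_small:
  fixes F :: "complex \<Rightarrow> complex"
  assumes [measurable]: "F \<in> borel_measurable borel"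
    and F: "integrable circle_measure (\<lambda>z. norm (F z) powr p)" and e: "0 < e"
  obtains N :: nat where "(LINT z|circle_measure. norm (F z) powr p * indicator {z. real N < norm (F z)} z) < e"
proof -
  have "(\<lambda>N. LINT z|circle_measure. norm (F z) powr p * indicator {z. real N < norm (F z)} z)
     \<longlonglongrightarrow> (LINT z|circle_measure. (0::real))"
  proof (rule integral_dominated_convergence[where w = "\<lambda>z. norm (F z) powr p"])
    show "AE z in circle_measure. (\<lambda>N. norm (F z) powr p * indicator {z. real N < norm (F z)} z) \<longlonglongrightarrow> 0"
    proof (intro AE_I2 tendsto_eventually)
      fix z
      obtain N :: nat where N: "norm (F z) \<le> real N" using real_arch_simple by blast
      have "norm (F z) powr p * indicator {z. real n < norm (F z)} z = 0" if "n \<ge> N" for n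
        using N that by simp
      then show "\<forall>\<^sub>F n in sequentially. norm (F z) powr p * indicator {z. real n < norm (F z)} z = 0"
        unfolding eventually_sequentially by blast
    qed
    show "AE z in circle_measure. norm (norm (F z) powr p * indicator {z. real N < norm (F z)} z) \<le> norm (F z) powr p" for N
      by (intro AE_I2) (simp add: indicator_def)
  qed (use F in auto)
  then have "eventually (\<lambda>N. (LINT z|circle_measure. norm (F z) powr p * indicator {z. real N < norm (F z)} z) < e) sequentially"
    using e by (intro order_tendstoD(2)) auto
  then show ?thesis using that by (auto simp: eventually_sequentially)
qed

text \<open>Continuity of rotations is at hand in L^1, so F is split at height N: the bounded part
  is paired with the L^1 difference of h and its rotation, while the tail \<open>f2\<close>, small
  in L^p, is controlled by Young's inequality.\<close>

lemma circle_pairing_continuous: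
  fixes F h :: "complex \<Rightarrow> complex"
  assumes Fm [measurable]: "F \<in> borel_measurable borel" and hm [measurable]: "h \<in> borel_measurable borel"
    and pq: "1 < p" "1 < q" "1 / p + 1 / q = 1"
    and F: "integrable circle_measure (\<lambda>z. norm (F z) powr p)"
    and h: "integrable circle_measure (\<lambda>z. norm (h z) powr q)"
    and e: "0 < e"
  obtains d where "0 < d" "\<And>w. norm w = 1 \<Longrightarrow> norm (w - 1) < d \<Longrightarrow>
    norm ((LINT z|circle_measure. F z * h (w * z)) - (LINT z|circle_measure. F z * h z)) \<le> e"
proof -
  define H where "H = (LINT z|circle_measure. norm (h z) powr q)"
  have H: "0 \<le> H" unfolding H_def by simp
  \<comment> \<open>A weight for Young's inequality, applied to f2/\<eta> and \<eta>|h|: it brings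
    the second term down to e/8, and H + 1 covers the case H = 0.\<close>
  define \<eta> where "\<eta> = (e / (8 * (H + 1))) powr (1 / q)"
  have \<eta>: "0 < \<eta>" using e H by (simp add: \<eta>_def)
  have "\<eta> powr q * H = e / 8 * (H / (H + 1))" using e H pq by (simp add: \<eta>_def powr_powr)
  also have "\<dots> \<le> e / 8 * 1" using e H by (intro mult_left_mono) auto
  finally have \<eta>H: "\<eta> powr q * H \<le> e / 8" by simp
  \<comment> \<open>The factor \<open>\<eta> powr p\<close> compensates the division of the tail by
    it in Young's inequality.\<close>
  have "0 < e / 8 * \<eta> powr p" using e \<eta> by simp
  from circle_tail_small[OF Fm F this] obtain N :: nat where
    N: "(LINT z|circle_measure. norm (F z) powr p * indicator {z. real N < norm (F z)} z) < e / 8 * \<eta> powr p" .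
  define f2 where "f2 z = norm (F z) * indicator {z. real N < norm (F z)} z" for z
  have f2_0: "0 \<le> f2 z" for z by (simp add: f2_def)
  have [measurable]: "f2 \<in> borel_measurable borel" unfolding f2_def by measurable
  have f2_powr: "f2 z powr p = norm (F z) powr p * indicator {z. real N < norm (F z)} z" for z
    by (simp add: f2_def indicator_def)
  have f2_int: "integrable circle_measure (\<lambda>z. f2 z powr p)"
    by (rule Bochner_Integration.integrable_bound[OF F]) (auto simp: f2_powr indicator_def)
  \<comment> \<open>Stated for every k with the same q-norm as h, since it is applied to h and to
    its rotation.\<close>
  have tail: "integrable circle_measure (\<lambda>z. f2 z * norm (k z))" 
    "(LINT z|circle_measure. f2 z * norm (k z)) \<le> e / 4"
    if km [measurable]: "k \<in> borel_measurable borel" and k: "integrable circle_measure (\<lambda>z. norm (k z) powr q)"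
      and kH: "(LINT z|circle_measure. norm (k z) powr q) = H" for k :: "complex \<Rightarrow> complex"
  proof -
    have young: "f2 z * norm (k z) \<le> f2 z powr p / \<eta> powr p + \<eta> powr q * norm (k z) powr q" for z
    proof -
      have "f2 z * norm (k z) = (f2 z / \<eta>) * (\<eta> * norm (k z))" using \<eta> by simp
      also have "\<dots> \<le> (f2 z / \<eta>) powr p / p + (\<eta> * norm (k z)) powr q / q"
        using \<eta> f2_0 by (intro Youngs_inequality[OF pq]) auto
      also have "\<dots> \<le> (f2 z / \<eta>) powr p + (\<eta> * norm (k z)) powr q"
        using pq by (intro add_mono) (auto simp: divide_le_eq mult_right_mono intro: mult_left_le[where 'a = real] order_trans[OF _ mult_left_mono[of 1]])
      finally show ?thesis using \<eta> f2_0 by (simp add: powr_mult powr_divide)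
    qed
    have int: "integrable circle_measure (\<lambda>z. f2 z powr p / \<eta> powr p + \<eta> powr q * norm (k z) powr q)"
      using f2_int k by auto
    show int2: "integrable circle_measure (\<lambda>z. f2 z * norm (k z))"
      by (rule Bochner_Integration.integrable_bound[OF int]) (use young f2_0 in \<open>auto intro!: order_trans[OF young abs_ge_self]\<close>)
    have "(LINT z|circle_measure. f2 z * norm (k z)) \<le> (LINT z|circle_measure. f2 z powr p / \<eta> powr p + \<eta> powr q * norm (k z) powr q)"
      by (rule integral_mono[OF int2 int young])
    also have "\<dots> = (LINT z|circle_measure. f2 z powr p) / \<eta> powr p + \<eta> powr q * H"
      using f2_int k by (simp add: kH)
    also have "(LINT z|circle_measure. f2 z powr p) / \<eta> powr p \<le> e / 8"
      using N \<eta> by (simp add: f2_powr pos_divide_le_eq)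
    finally show "(LINT z|circle_measure. f2 z * norm (k z)) \<le> e / 4" using \<eta>H by simp
  qed
  have h1: "integrable circle_measure h"
    using integrable_circle_powr[OF hm _ h] pq(2) by simp
  \<comment> \<open>Multiplied by the height N of the bounded part, this costs at most e/4.\<close>
  have "0 < e / (4 * (real N + 1))" using e by simp
  from circle_rotation_continuous[OF h1 this] obtain d where d: "0 < d"
    "\<And>w. norm w = 1 \<Longrightarrow> norm (w - 1) < d \<Longrightarrow> (LINT z|circle_measure. norm (h (w * z) - h z)) < e / (4 * (real N + 1))" by blast
  show ?thesis
  proof (rule that[OF d(1)])
    fix w :: complex assume w: "norm w = 1" "norm (w - 1) < d"
    have hw: "integrable circle_measure (\<lambda>z. norm (h (w * z)) powr q)" "(LINT z|circle_measure. norm (h (w * z)) powr q) = H"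
      using integral_circle_rotate[OF w(1), of "\<lambda>z. norm (h z) powr q"] h by (simp_all add: H_def)
    have hwm [measurable]: "(\<lambda>z. h (w * z)) \<in> borel_measurable borel" by measurable
    have hw1: "integrable circle_measure (\<lambda>z. h (w * z))"
      using integral_circle_rotate(2)[OF w(1) hm] h1 by simp
    have Fh: "integrable circle_measure (\<lambda>z. F z * h z)" "integrable circle_measure (\<lambda>z. F z * h (w * z))"
      using integrable_circle_mult[OF Fm hm pq F h] integrable_circle_mult[OF Fm hwm pq F hw(1)] by auto
    have "norm ((LINT z|circle_measure. F z * h (w * z)) - (LINT z|circle_measure. F z * h z))
       = norm (LINT z|circle_measure. F z * h (w * z) - F z * h z)"
      using Fh by simp
    also have "\<dots> \<le> (LINT z|circle_measure. norm (F z * h (w * z) - F z * h z))" by (rule integral_norm_bound)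
    also have "\<dots> \<le> (LINT z|circle_measure. f2 z * norm (h (w * z)) + f2 z * norm (h z) + real N * norm (h (w * z) - h z))"
    proof (rule integral_mono)
      fix z
      have eq: "norm (F z * h (w * z) - F z * h z) = norm (F z) * norm (h (w * z) - h z)"
        by (simp flip: norm_mult right_diff_distrib)
      show "norm (F z * h (w * z) - F z * h z) \<le> f2 z * norm (h (w * z)) + f2 z * norm (h z) + real N * norm (h (w * z) - h z)"
      proof (cases "real N < norm (F z)")
        case True
        have "norm (F z) * norm (h (w * z) - h z) \<le> norm (F z) * (norm (h (w * z)) + norm (h z))"
          by (intro mult_left_mono norm_triangle_ineq4) simp
        then show ?thesis unfolding eq using True by (simp add: f2_def distrib_left add_increasing2)
      next
        case False
        then have "norm (F z) * norm (h (w * z) - h z) \<le> real N * norm (h (w * z) - h z)"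
          by (intro mult_right_mono) auto
        then show ?thesis unfolding eq using False by (simp add: f2_def)
      qed
    qed (use Fh tail(1)[OF hm h H_def[symmetric]] tail(1)[OF hwm hw] h1 hw1 in auto)
    also have "\<dots> = (LINT z|circle_measure. f2 z * norm (h (w * z))) + (LINT z|circle_measure. f2 z * norm (h z)) + real N * (LINT z|circle_measure. norm (h (w * z) - h z))"
      using tail(1)[OF hm h H_def[symmetric]] tail(1)[OF hwm hw] h1 hw1 by simp
    also have "\<dots> \<le> e / 4 + e / 4 + (real N + 1) * (e / (4 * (real N + 1)))"
      using tail(2)[OF hm h H_def[symmetric]] tail(2)[OF hwm hw] d(2)[OF w] e
      by (intro add_mono mult_mono) auto
    also have "(real N + 1) * (e / (4 * (real N + 1))) = e / 4" by (simp add: field_simps)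
    finally show "norm ((LINT z|circle_measure. F z * h (w * z)) - (LINT z|circle_measure. F z * h z)) \<le> e"
      using e by simp
  qed
qed

text \<open>The correlation \<open>\<Phi>(w) = \<integral> f(t) t\<^sup>k h(tw) dt\<close> has vanishing Fourier coefficients except for the
  zeroth one, hence is constant almost everywhere; it is also continuous at \<open>1\<close>, which gives the
  value \<open>\<Phi>(1)\<close>. No density of analytic polynomials in the Hardy space is needed.\<close>

lemma circle_hardy_product:
  fixes f h :: "complex \<Rightarrow> complex" and k :: int
  assumes fm [measurable]: "f \<in> borel_measurable borel" and hm [measurable]: "h \<in> borel_measurable borel"
    and pq: "1 < p" "1 < q" "1 / p + 1 / q = 1"
    and f: "integrable circle_measure (\<lambda>z. norm (f z) powr p)"
    and h: "integrable circle_measure (\<lambda>z. norm (h z) powr q)"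
    and f0: "\<And>j::int. 0 < j \<Longrightarrow> (LINT z|circle_measure. f z * z powi j) = 0"
    and h0: "\<And>j::int. 0 < j \<Longrightarrow> (LINT z|circle_measure. h z * z powi j) = 0"
    and k: "0 \<le> k"
  shows "(LINT z|circle_measure. f z * h z * z powi k) = (LINT z|circle_measure. f z * z powi k) * (LINT z|circle_measure. h z)"
proof -
  note [measurable] = powi_borel
  define F where "F z = f z * z powi k" for z
  define c where "c = (LINT z|circle_measure. F z) * (LINT z|circle_measure. h z)"
  have Fm [measurable]: "F \<in> borel_measurable borel" unfolding F_def by measurable
  have Fp: "integrable circle_measure (\<lambda>z. norm (F z) powr p)"
  proof -
    have "AE z in circle_measure. norm (f z) powr p = norm (F z) powr p"
      using AE_circle_norm by eventually_elim (simp add: F_def norm_mult norm_power_int)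
    then show ?thesis by (intro integrable_cong_AE_imp[OF f]) measurable
  qed
  have f1: "integrable circle_measure f" and h1: "integrable circle_measure h" and F1: "integrable circle_measure F"
    using integrable_circle_powr[OF fm _ f] integrable_circle_powr[OF hm _ h] integrable_circle_powr[OF Fm _ Fp] pq by auto
  define \<Phi> where "\<Phi> w = (LINT t|circle_measure. F t * h (t * w))" for w
  have \<Phi>_int: "integrable circle_measure \<Phi>"
    unfolding \<Phi>_def by (rule circle_correlation(1)[OF F1 h1])
  have "(LINT w|circle_measure. (\<Phi> w - c) * w powi m) = 0" for m :: int
  proof -
    have corr: "(LINT w|circle_measure. \<Phi> w * w powi m) = (LINT t|circle_measure. F t * t powi (- m)) * (LINT w|circle_measure. h w * w powi m)"
      unfolding \<Phi>_def by (rule circle_correlation(2)[OF F1 h1])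
    have split: "(LINT w|circle_measure. (\<Phi> w - c) * w powi m) = (LINT w|circle_measure. \<Phi> w * w powi m) - c * (LINT w|circle_measure. w powi m)"
    proof -
      have "integrable circle_measure (\<lambda>w. w powi m)"
        using integrable_circle_mult_powi[of "\<lambda>_. 1" m] by simp
      then show ?thesis using integrable_circle_mult_powi[OF \<Phi>_int, of m] by (simp add: left_diff_distrib)
    qed
    \<comment> \<open>Positive m is killed by h, negative m by f, because F is f shifted by k >= 0
      and k - m > 0; only m = 0 leaves the constant c.\<close>
    consider "m > 0" | "m = 0" | "m < 0" by linarith
    then show ?thesis
    proof cases
      case 1
      then show ?thesis using split corr h0[of m] integral_circle_powi[of m] by simp
    next
      case 2
      then show ?thesis using split corr by (simp add: c_def measure_def prob_circle_measure)
    next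
      case 3
      have "(LINT t|circle_measure. F t * t powi (- m)) = (LINT t|circle_measure. f t * t powi (k - m))"
      proof (rule integral_cong_AE)
        show "AE t in circle_measure. F t * t powi (- m) = f t * t powi (k - m)"
          using AE_circle_norm
        proof eventually_elim
          fix t :: complex assume "norm t = 1"
          then have "t \<noteq> 0" by auto
          then have "t powi (k + (- m)) = t powi k * t powi (- m)" by (intro power_int_add) auto
          then show "F t * t powi (- m) = f t * t powi (k - m)" by (simp add: F_def)
        qed
      qed measurable
      also have "\<dots> = 0" using 3 k by (intro f0) simp
      finally show ?thesis using split corr 3 integral_circle_powi[of m] by simp
    qed
  qed
  then have "AE w in circle_measure. \<Phi> w - c = 0"
    using \<Phi>_int by (intro circle_fourier_unique) auto
  then have ae: "AE w in circle_measure. \<Phi> w = c" by eventually_elim simp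
  have close: "norm (c - (LINT z|circle_measure. F z * h z)) \<le> e" if "0 < e" for e
  proof -
    from circle_pairing_continuous[OF Fm hm pq Fp h that] obtain d where d: "0 < d"
      "\<And>w. norm w = 1 \<Longrightarrow> norm (w - 1) < d \<Longrightarrow>
         norm ((LINT z|circle_measure. F z * h (w * z)) - (LINT z|circle_measure. F z * h z)) \<le> e" by blast
    \<comment> \<open>The value c is attained at points w near 1, where \<open>\<Phi>\<close> is
      within e of its value at 1.\<close>
    from AE_circle_near_one[OF ae d(1)] obtain w where "norm w = 1" "norm (w - 1) < d" "\<Phi> w = c" by blast
    with d(2)[of w] show ?thesis by (simp add: \<Phi>_def mult.commute)
  qed
  have "norm (c - (LINT z|circle_measure. F z * h z)) \<le> 0"
    by (rule field_le_epsilon) (simp only: add_0 close)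
  then have "c = (LINT z|circle_measure. F z * h z)" by simp
  moreover have "f z * h z * z powi k = F z * h z" for z by (simp add: F_def)
  ultimately show ?thesis by (simp only: c_def F_def)
qed

section \<open>Calculus of circle functions\<close>

lemma circle_eq_refl_iff: "circle_eq f f \<longleftrightarrow> f \<in> borel_measurable borel"
  by (simp add: circle_eq_def)

lemma circle_eqI:
  assumes "f \<in> borel_measurable borel" "g \<in> borel_measurable borel"
    and "\<And>z. norm z = 1 \<Longrightarrow> f z = g z"
  shows "circle_eq f g"
  using assms(1,2) AE_circle_norm unfolding circle_eq_def by (auto elim!: eventually_mono intro: assms(3))

text \<open>At z = 0 the law of exponents can fail, as for a = 1 and b = -1; it is therefore checked
  on the circle.\<close>

lemma tpow_add: "tpow (a + b) = tpow a * tpow b"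
proof transfer
  fix a b :: int
  note [measurable] = powi_borel
  show "circle_eq (\<lambda>z. z powi (a + b)) (\<lambda>z. z powi a * z powi b)"
    by (rule circle_eqI) (measurable, auto intro!: power_int_add)
qed

lemma tpow_0: "tpow 0 = 1"
  by transfer (simp add: circle_eq_def)

lemma tpow_cancel [simp]: "tpow a * tpow (- a) = 1"
  by (simp add: tpow_0 flip: tpow_add)

lemma cscale_mult_left: "(c *\<^sub>C f) * g = c *\<^sub>C (f * g)"
  by transfer (simp add: circle_eq_def mult.assoc)

lemma cscale_mult_right: "f * (c *\<^sub>C g) = c *\<^sub>C (f * g)"
  by (metis cscale_mult_left mult.commute)

lemma borel_recip:
  assumes [measurable]: "f \<in> borel_measurable (borel :: complex measure)"
  shows "(\<lambda>z. f (1 / z)) \<in> borel_measurable borel"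
  by measurable

lemma reflect_mult: "reflect (f * g) = reflect f * reflect g"
  by transfer (simp add: circle_eq_def borel_recip)

lemma reflect_one: "reflect 1 = 1"
  by transfer (simp add: circle_eq_def)

lemma reflect_cscale: "reflect (c *\<^sub>C f) = c *\<^sub>C reflect f"
  by transfer (simp add: circle_eq_def borel_recip)

lemma reflect_reflect [simp]: "reflect (reflect f) = f"
  by transfer (simp add: circle_eq_def)

lemma reflect_tpow: "reflect (tpow k) = tpow (- k)"
proof transfer
  fix k :: int
  note [measurable] = powi_borel
  show "circle_eq (\<lambda>z. (1 / z) powi k) (\<lambda>z. z powi - k)"
    by (rule circle_eqI) (measurable, auto simp: power_int_minus power_int_divide_distrib field_simps)
qed

text \<open>On the circle cnj z = 1/z. This reduces J to a reflection and a shift, to which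
  multiplicative rules apply.\<close>

lemma flip_J_eq: "flip_J f = tpow (- 1) * reflect f"
proof transfer
  fix f :: "complex \<Rightarrow> complex" assume "circle_eq f f"
  then have [measurable]: "f \<in> borel_measurable borel" by (simp add: circle_eq_refl_iff)
  note [measurable] = powi_borel
  have [measurable]: "cnj \<in> borel_measurable borel"
    by (intro borel_measurable_continuous_onI continuous_intros)
  show "circle_eq (\<lambda>z. cnj z * f (cnj z)) (\<lambda>z. z powi - 1 * f (1 / z))"
  proof (rule circle_eqI)
    fix z :: complex assume "norm z = 1"
    then have "z * cnj z = 1" by (simp add: complex_norm_square[symmetric])
    then have "cnj z = inverse z" by (rule inverse_unique[symmetric])
    then show "cnj z * f (cnj z) = z powi - 1 * f (1 / z)" by (simp add: divide_inverse)
  qed measurable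
qed

section \<open>Membership in L^p\<close>

lemma Lp_1I:
  assumes "f \<in> Lp p" "1 \<le> p" shows "f \<in> Lp 1"
  using assms unfolding Lp_def mem_Collect_eq
proof transfer
  fix f :: "complex \<Rightarrow> complex" and p :: real
  assume "circle_eq f f" and f: "integrable circle_measure (\<lambda>z. norm (f z) powr p)" "1 \<le> p"
  then have "f \<in> borel_measurable borel" by (simp add: circle_eq_refl_iff)
  from integrable_circle_powr[OF this f(2,1)] show "integrable circle_measure (\<lambda>z. norm (f z) powr 1)"
    by simp
qed

lemma Lp_0 [simp]: "0 \<in> Lp p"
  unfolding Lp_def mem_Collect_eq by transfer simp

lemma Lp_tpow [simp]: "tpow k \<in> Lp p"
  unfolding Lp_def mem_Collect_eq
proof transfer
  fix k :: int and p :: real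
  note [measurable] = powi_borel
  have "AE z in circle_measure. (1::real) = norm (z powi k :: complex) powr p"
    using AE_circle_norm by eventually_elim (simp add: norm_power_int)
  then show "integrable circle_measure (\<lambda>z. norm (z powi k :: complex) powr p)"
    by (rule integrable_cong_AE_imp[rotated 2]) (simp, measurable)
qed

lemma Lp_cscale: "f \<in> Lp p \<Longrightarrow> c *\<^sub>C f \<in> Lp p"
  unfolding Lp_def mem_Collect_eq by transfer (simp add: norm_mult powr_mult)

lemma Lp_add:
  assumes "f \<in> Lp p" "g \<in> Lp p" "0 \<le> p" shows "f + g \<in> Lp p"
  using assms unfolding Lp_def mem_Collect_eq
proof transfer
  fix f g :: "complex \<Rightarrow> complex" and p :: real
  assume "circle_eq f f" "circle_eq g g" and fg: "integrable circle_measure (\<lambda>z. norm (f z) powr p)"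
    "integrable circle_measure (\<lambda>z. norm (g z) powr p)" and p: "0 \<le> p"
  then have [measurable]: "f \<in> borel_measurable borel" "g \<in> borel_measurable borel" by (simp_all add: circle_eq_refl_iff)
  show "integrable circle_measure (\<lambda>z. norm (f z + g z) powr p)"
  proof (rule Bochner_Integration.integrable_bound)
    show "integrable circle_measure (\<lambda>z. 2 powr p * (norm (f z) powr p + norm (g z) powr p))" using fg by simp
    show "AE z in circle_measure. norm (norm (f z + g z) powr p) \<le> norm (2 powr p * (norm (f z) powr p + norm (g z) powr p))"
    proof (intro AE_I2)
      fix z
      define M where "M = max (norm (f z)) (norm (g z))"
      have "norm (f z + g z) \<le> 2 * M" using norm_triangle_ineq[of "f z" "g z"] by (simp add: M_def)
      then have "norm (f z + g z) powr p \<le> (2 * M) powr p" using p by (intro powr_mono2) auto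
      also have "\<dots> = 2 powr p * M powr p" by (simp add: powr_mult M_def)
      also have "M powr p \<le> norm (f z) powr p + norm (g z) powr p" by (simp add: M_def max_def)
      finally show "norm (norm (f z + g z) powr p) \<le> norm (2 powr p * (norm (f z) powr p + norm (g z) powr p))" by simp
    qed
  qed measurable
qed

lemma Lp_mult:
  assumes "f \<in> Lp p" "h \<in> Lp q" "1 < p" "1 < q" "1 / p + 1 / q = 1" shows "f * h \<in> Lp 1"
  using assms unfolding Lp_def mem_Collect_eq
proof transfer
  fix f h :: "complex \<Rightarrow> complex" and p q :: real
  assume "circle_eq f f" "circle_eq h h" and fh: "integrable circle_measure (\<lambda>z. norm (f z) powr p)"
    "integrable circle_measure (\<lambda>z. norm (h z) powr q)" and pq: "1 < p" "1 < q" "1 / p + 1 / q = 1"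
  then have "f \<in> borel_measurable borel" "h \<in> borel_measurable borel" by (simp_all add: circle_eq_refl_iff)
  from integrable_circle_mult[OF this pq fh]
  show "integrable circle_measure (\<lambda>z. norm (f z * h z) powr 1)" by simp
qed

lemma Lp_Linf_mult:
  assumes "g \<in> Linf" "f \<in> Lp p" "0 \<le> p" shows "g * f \<in> Lp p"
  using assms unfolding Lp_def Linf_def mem_Collect_eq
proof transfer
  fix g f :: "complex \<Rightarrow> complex" and p :: real
  assume "circle_eq g g" "circle_eq f f" and f: "integrable circle_measure (\<lambda>z. norm (f z) powr p)"
    and g: "\<exists>C. AE z in circle_measure. norm (g z) \<le> C" and p: "0 \<le> p"
  then have [measurable]: "f \<in> borel_measurable borel" "g \<in> borel_measurable borel" by (simp_all add: circle_eq_refl_iff)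
  obtain C where C: "AE z in circle_measure. norm (g z) \<le> C" using g by blast
  show "integrable circle_measure (\<lambda>z. norm (g z * f z) powr p)"
  proof (rule Bochner_Integration.integrable_bound)
    show "integrable circle_measure (\<lambda>z. C powr p * norm (f z) powr p)" using f by simp
    show "AE z in circle_measure. norm (norm (g z * f z) powr p) \<le> norm (C powr p * norm (f z) powr p)"
      using C
    proof eventually_elim
      fix z assume "norm (g z) \<le> C"
      then have "norm (g z) powr p \<le> C powr p" using p by (intro powr_mono2) auto
      then show "norm (norm (g z * f z) powr p) \<le> norm (C powr p * norm (f z) powr p)"
        by (simp add: norm_mult powr_mult mult_right_mono)
    qed
  qed measurable
qed

lemma Linf_tpow: "tpow k \<in> Linf"
  unfolding Linf_def mem_Collect_eq
proof transfer
  fix k :: int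
  have "AE z in circle_measure. norm (z powi k :: complex) \<le> 1"
    using AE_circle_norm by eventually_elim (simp add: norm_power_int)
  then show "\<exists>C. AE z in circle_measure. norm (z powi k :: complex) \<le> C" by blast
qed

lemma Lp_reflect: "f \<in> Lp p \<Longrightarrow> reflect f \<in> Lp p"
  unfolding Lp_def mem_Collect_eq
proof transfer
  fix f :: "complex \<Rightarrow> complex" and p :: real
  assume "circle_eq f f" and f: "integrable circle_measure (\<lambda>z. norm (f z) powr p)"
  then have [measurable]: "f \<in> borel_measurable borel" by (simp add: circle_eq_refl_iff)
  have "(\<lambda>z. norm (f z) powr p) \<in> borel_measurable borel" by measurable
  from integral_circle_inverse(2)[OF this] f
  show "integrable circle_measure (\<lambda>z. norm (f (1 / z)) powr p)" by simp
qed

section \<open>Rules for Fourier coefficients\<close>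

lemma fourier_add:
  assumes "f \<in> Lp 1" "g \<in> Lp 1" shows "fourier (f + g) n = fourier f n + fourier g n"
  using assms unfolding Lp_def mem_Collect_eq
proof transfer
  fix f g :: "complex \<Rightarrow> complex" and n :: int
  assume "circle_eq f f" "circle_eq g g" "integrable circle_measure (\<lambda>z. norm (f z) powr 1)"
    "integrable circle_measure (\<lambda>z. norm (g z) powr 1)"
  then have "integrable circle_measure f" "integrable circle_measure g"
    by (simp_all add: circle_eq_refl_iff integrable_norm_iff borel_measurable_circle_iff)
  from this[THEN integrable_circle_mult_powi, of "- n"]
  show "(LINT z|circle_measure. (f z + g z) * z powi - n) = (LINT z|circle_measure. f z * z powi - n) + (LINT z|circle_measure. g z * z powi - n)"
    by (simp add: distrib_right)
qed

lemma fourier_cscale: "fourier (c *\<^sub>C f) n = c * fourier f n"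
  by transfer (simp add: mult.assoc)

lemma fourier_0 [simp]: "fourier 0 n = 0"
  by transfer simp

lemma fourier_tpow_mult: "fourier (tpow k * f) n = fourier f (n - k)"
proof transfer
  fix f :: "complex \<Rightarrow> complex" and n k :: int
  assume "circle_eq f f"
  then have [measurable]: "f \<in> borel_measurable borel" by (simp add: circle_eq_refl_iff)
  note [measurable] = powi_borel
  show "(LINT z|circle_measure. z powi k * f z * z powi - n) = (LINT z|circle_measure. f z * z powi - (n - k))"
  proof (rule integral_cong_AE)
    show "AE z in circle_measure. z powi k * f z * z powi - n = f z * z powi - (n - k)"
      using AE_circle_norm
    proof eventually_elim
      fix z :: complex assume "norm z = 1"
      then have "z \<noteq> 0" by auto
      then have "z powi (k + (- n)) = z powi k * z powi (- n)" by (intro power_int_add) auto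
      then show "z powi k * f z * z powi - n = f z * z powi - (n - k)" by simp
    qed
  qed measurable
qed

lemma fourier_one: "fourier 1 n = (if n = 0 then 1 else 0)"
  by transfer (auto simp: integral_circle_powi measure_def prob_circle_measure)

lemma fourier_tpow: "fourier (tpow k) n = (if n = k then 1 else 0)"
  using fourier_tpow_mult[of k 1 n] by (simp add: fourier_one)

lemma fourier_reflect: "fourier (reflect f) n = fourier f (- n)"
proof transfer
  fix f :: "complex \<Rightarrow> complex" and n :: int
  assume "circle_eq f f"
  then have [measurable]: "f \<in> borel_measurable borel" by (simp add: circle_eq_refl_iff)
  note [measurable] = powi_borel
  have "(LINT z|circle_measure. f (1 / z) * z powi - n) = (LINT z|circle_measure. f (1 / z) * (1 / z) powi n)"
    by (simp add: power_int_minus power_int_inverse divide_inverse)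
  also have "\<dots> = (LINT z|circle_measure. f z * z powi n)"
    by (rule integral_circle_inverse(1)) measurable
  finally show "(LINT z|circle_measure. f (1 / z) * z powi - n) = (LINT z|circle_measure. f z * z powi - (- n))" by simp
qed

lemma fourier_unique:
  assumes "f \<in> Lp 1" "\<And>n. fourier f n = 0" shows "f = 0"
  using assms unfolding Lp_def mem_Collect_eq
proof transfer
  fix f :: "complex \<Rightarrow> complex"
  assume f: "circle_eq f f" "integrable circle_measure (\<lambda>z. norm (f z) powr 1)"
    "\<And>n. (LINT z|circle_measure. f z * z powi - n) = 0"
  have "(LINT z|circle_measure. f z * z powi k) = 0" for k :: int using f(3)[of "- k"] by simp
  moreover have "integrable circle_measure f"
    using f by (simp add: circle_eq_refl_iff integrable_norm_iff borel_measurable_circle_iff)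
  ultimately show "circle_eq f (\<lambda>_. 0)"
    using f(1) circle_fourier_unique[of f] by (simp add: circle_eq_def)
qed

text \<open>One formula for two facts: the product acquires no negative frequencies (n < 0), and
  evaluation at 0 is multiplicative (n = 0).\<close>

lemma fourier_Hp_mult:
  assumes "f \<in> Hp p" "h \<in> Hp q" "1 < p" "1 < q" "1 / p + 1 / q = 1" "n \<le> 0"
  shows "fourier (f * h) n = fourier f n * fourier h 0"
proof -
  have "in_Lp p f" "in_Lp q h" "\<And>n. n < 0 \<Longrightarrow> fourier f n = 0" "\<And>n. n < 0 \<Longrightarrow> fourier h n = 0"
    using assms(1,2) by (simp_all add: Hp_def Lp_def)
  then show ?thesis using assms(3-)
  proof transfer
    fix f h :: "complex \<Rightarrow> complex" and p q :: real and n :: int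
    assume "circle_eq f f" "circle_eq h h" and fh: "integrable circle_measure (\<lambda>z. norm (f z) powr p)"
      "integrable circle_measure (\<lambda>z. norm (h z) powr q)"
      and f0: "\<And>n. n < 0 \<Longrightarrow> (LINT z|circle_measure. f z * z powi - n) = 0"
      and h0: "\<And>n. n < 0 \<Longrightarrow> (LINT z|circle_measure. h z * z powi - n) = 0"
      and pq: "1 < p" "1 < q" "1 / p + 1 / q = 1" and n: "n \<le> 0"
    then have m: "f \<in> borel_measurable borel" "h \<in> borel_measurable borel" by (simp_all add: circle_eq_refl_iff)
    show "(LINT z|circle_measure. f z * h z * z powi - n) = (LINT z|circle_measure. f z * z powi - n) * (LINT z|circle_measure. h z * z powi - 0)"
      using circle_hardy_product[OF m pq fh, of "- n"] f0[of "- j" for j] h0[of "- j" for j] n by simp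
  qed
qed

section \<open>Wiener--Hopf factorizations of matching functions\<close>

lemma conj_exponent:
  assumes "1 < p"
  shows "1 < conj_exponent p" "1 / p + 1 / conj_exponent p = 1"
  using assms by (auto simp: conj_exponent_def field_simps)

lemma Hp_0 [simp]: "0 \<in> Hp p"
  by (simp add: Hp_def)

lemma Hp_add: "f \<in> Hp p \<Longrightarrow> g \<in> Hp p \<Longrightarrow> 1 \<le> p \<Longrightarrow> f + g \<in> Hp p"
  using Lp_1I[of f p] Lp_1I[of g p] by (simp add: Hp_def Lp_add fourier_add)

lemma Hp_cscale: "f \<in> Hp p \<Longrightarrow> c *\<^sub>C f \<in> Hp p"
  by (simp add: Hp_def Lp_cscale fourier_cscale)

lemma diff_eq_add_cscale: "f - g = f + (- 1) *\<^sub>C g"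
  by (simp add: circle.scale_minus_left)

lemma Lp_diff: "f \<in> Lp p \<Longrightarrow> g \<in> Lp p \<Longrightarrow> 0 \<le> p \<Longrightarrow> f - g \<in> Lp p"
  unfolding diff_eq_add_cscale by (intro Lp_add Lp_cscale)

lemma fourier_diff: "f \<in> Lp 1 \<Longrightarrow> g \<in> Lp 1 \<Longrightarrow> fourier (f - g) n = fourier f n - fourier g n"
  unfolding diff_eq_add_cscale by (subst fourier_add) (simp_all only: Lp_cscale fourier_cscale, simp)

lemma Hp_diff: "f \<in> Hp p \<Longrightarrow> g \<in> Hp p \<Longrightarrow> 1 \<le> p \<Longrightarrow> f - g \<in> Hp p"
  unfolding diff_eq_add_cscale by (intro Hp_add Hp_cscale)

lemma Hp_tpow: "0 \<le> k \<Longrightarrow> tpow k \<in> Hp p"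
  by (simp add: Hp_def fourier_tpow)

lemma Lp_tpow_mult: "f \<in> Lp p \<Longrightarrow> 0 \<le> p \<Longrightarrow> tpow k * f \<in> Lp p"
  by (rule Lp_Linf_mult[OF Linf_tpow])

lemma Hp_tpow_mult: "f \<in> Hp p \<Longrightarrow> 0 \<le> p \<Longrightarrow> 0 \<le> k \<Longrightarrow> tpow k * f \<in> Hp p"
  by (simp add: Hp_def Lp_tpow_mult fourier_tpow_mult)

lemma Hp_reflect_iff: "reflect f \<in> Hp p \<longleftrightarrow> f \<in> Hp_bar p"
proof -
  have "reflect f \<in> Lp p \<longleftrightarrow> f \<in> Lp p" using Lp_reflect[of f p] Lp_reflect[of "reflect f" p] by auto
  moreover have "(\<forall>n<0. fourier f (- n) = 0) \<longleftrightarrow> (\<forall>n>0. fourier f n = 0)"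
    by (metis minus_minus neg_0_less_iff_less neg_less_0_iff_less)
  ultimately show ?thesis by (simp add: Hp_def Hp_bar_def fourier_reflect)
qed

lemma fourier_Hp_bar_mult:
  assumes "f \<in> Hp_bar p" "h \<in> Hp_bar q" "1 < p" "1 < q" "1 / p + 1 / q = 1" "0 \<le> n"
  shows "fourier (f * h) n = fourier f n * fourier h 0"
proof -
  have "fourier (reflect f * reflect h) (- n) = fourier (reflect f) (- n) * fourier (reflect h) 0"
    using assms by (intro fourier_Hp_mult) (simp_all add: Hp_reflect_iff)
  then show ?thesis by (simp add: fourier_reflect flip: reflect_mult)
qed

lemma Hp_mult_Lp:
  assumes "f \<in> Hp p" "h \<in> Hp q" "1 < p" "1 < q" "1 / p + 1 / q = 1"
  shows "f * h \<in> Lp 1"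
  using assms Lp_mult[of f p h q] by (simp add: Hp_def)

text \<open>The left side has no frequency below 0 and the right side none above k, which is
  negative; nothing is left.\<close>

lemma Hp_eq_shifted_Hp_bar_imp_0:
  assumes a: "a \<in> Hp p" "b \<in> Hp q" and c: "c \<in> Hp_bar p" "d \<in> Hp_bar q"
    and pq: "1 < p" "1 < q" "1 / p + 1 / q = 1"
    and eq: "a * b = tpow k * (c * d)" and k: "k < 0"
  shows "a * b = 0"
proof (rule fourier_unique)
  show "a * b \<in> Lp 1" using a pq by (rule Hp_mult_Lp)
  show "fourier (a * b) n = 0" for n
  proof (cases "n < 0")
    case True
    then have "fourier (a * b) n = fourier a n * fourier b 0" by (intro fourier_Hp_mult[OF a pq]) simp
    with True a show ?thesis by (simp add: Hp_def)
  next
    case False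
    have "fourier (a * b) n = fourier (c * d) (n - k)" unfolding eq by (rule fourier_tpow_mult)
    also have "\<dots> = fourier c (n - k) * fourier d 0" by (rule fourier_Hp_bar_mult[OF c pq]) (use False k in simp)
    finally show ?thesis using c False k by (simp add: Hp_bar_def)
  qed
qed

text \<open>Only frequency 0 is common to both sides. Its coefficient, computed from either side,
  gives the second claim.\<close>

lemma Hp_eq_Hp_bar_imp_const:
  assumes a: "a \<in> Hp p" "b \<in> Hp q" and c: "c \<in> Hp_bar p" "d \<in> Hp_bar q"
    and pq: "1 < p" "1 < q" "1 / p + 1 / q = 1"
    and eq: "a * b = c * d"
  shows "a * b = (fourier a 0 * fourier b 0) *\<^sub>C 1"
    and "fourier a 0 * fourier b 0 = fourier c 0 * fourier d 0"
proof -
  let ?s = "fourier a 0 * fourier b 0"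
  have L: "a * b \<in> Lp 1" using a pq by (rule Hp_mult_Lp)
  have neg: "fourier (a * b) n = 0" if "n < 0" for n
    using fourier_Hp_mult[OF a pq, of n] a that by (simp add: Hp_def)
  have pos: "fourier (a * b) n = 0" if "n > 0" for n
    using fourier_Hp_bar_mult[OF c pq, of n] c that by (simp add: Hp_bar_def eq)
  have zero: "fourier (a * b) 0 = ?s" by (intro fourier_Hp_mult[OF a pq]) simp
  have L1: "?s *\<^sub>C 1 \<in> Lp 1" using Lp_tpow[of 0 1] by (intro Lp_cscale) (simp add: tpow_0)
  have "a * b - ?s *\<^sub>C 1 = 0"
  proof (rule fourier_unique)
    show "a * b - ?s *\<^sub>C 1 \<in> Lp 1" using L L1 by (intro Lp_diff) auto
    show "fourier (a * b - ?s *\<^sub>C 1) n = 0" for n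
      using neg[of n] pos[of n] zero L L1
      by (cases n "0 :: int" rule: linorder_cases) (simp_all add: fourier_diff fourier_cscale fourier_one)
  qed
  then show "a * b = ?s *\<^sub>C 1" by simp
  show "?s = fourier c 0 * fourier d 0"
    using zero fourier_Hp_bar_mult[OF c pq, of 0] by (simp add: eq)
qed

lemma wiener_hopfD:
  assumes "wiener_hopf p a m \<nu> u"
  shows "a = m * tpow \<nu> * u" "u * inverse u = 1" "m * inverse m = 1"
    "u \<in> Hp (conj_exponent p)" "inverse u \<in> Hp p" "m \<in> Hp_bar p" "inverse m \<in> Hp_bar (conj_exponent p)"
    "fourier m 0 = 1"
  using assms by (simp_all add: wiener_hopf_def Let_def at_infty_def)

lemma wiener_hopf_inverse_minus_at_infty:
  assumes p: "1 < p" and wh: "wiener_hopf p a m \<nu> u"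
  shows "fourier (inverse m) 0 = 1"
proof -
  note w = wiener_hopfD[OF wh]
  have "fourier (m * inverse m) 0 = fourier m 0 * fourier (inverse m) 0"
    using w(6,7) p conj_exponent[OF p] by (rule fourier_Hp_bar_mult) simp
  then show ?thesis using w by (simp add: fourier_one)
qed

text \<open>The quotient of u' by u is analytic and equals t^(\<nu> - \<nu>') times that of m by m'.
  For \<nu> < \<nu>' it would be 0, which invertibility forbids; for equal exponents it is a
  constant, and the normalization at infinity makes it 1. Symmetry removes the order of the
  exponents afterwards.\<close>

lemma wiener_hopf_plus_unique_aux:
  assumes p: "1 < p" and wh: "wiener_hopf p a m \<nu> u" and wh': "wiener_hopf p a m' \<nu>' u'" and le: "\<nu> \<le> \<nu>'"
  shows "u' = u"
proof -
  let ?q = "conj_exponent p"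
  note pq = conj_exponent[OF p]
  have qp: "1 / ?q + 1 / p = 1" using pq by simp
  note w = wiener_hopfD[OF wh] and w' = wiener_hopfD[OF wh']
  \<comment> \<open>The ring has zero divisors, so cancellation is done by inserting products equal
    to 1.\<close>
  have "inverse u * u' = (inverse u * u) * (m * inverse m) * (inverse m' * m') * (tpow (- \<nu>') * tpow \<nu>') * (inverse u * u')"
    using w(2,3) w'(2,3) by (simp add: mult.commute)
  also have "\<dots> = tpow (- \<nu>') * inverse u * inverse m' * (m' * tpow \<nu>' * u') * (inverse u * u) * (m * inverse m)"
    by (simp only: mult_ac)
  also have "\<dots> = tpow (- \<nu>') * inverse u * inverse m' * (m * tpow \<nu> * u)"
    using w w' by (simp add: mult.commute)
  also have "\<dots> = (tpow \<nu> * tpow (- \<nu>')) * (m * inverse m') * (u * inverse u)"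
    by (simp only: mult_ac)
  also have "\<dots> = tpow (\<nu> - \<nu>') * (m * inverse m')"
    using w(2) by (simp flip: tpow_add)
  finally have eq: "inverse u * u' = tpow (\<nu> - \<nu>') * (m * inverse m')" .
  have "inverse u * u' \<noteq> 0"
  proof
    assume "inverse u * u' = 0"
    then have "u * (inverse u * u') * inverse u' = 0" by simp
    moreover have "u * (inverse u * u') * inverse u' = (u * inverse u) * (u' * inverse u')" by (simp only: mult_ac)
    ultimately show False using w(2) w'(2) by simp
  qed
  then have "\<nu> = \<nu>'"
    using Hp_eq_shifted_Hp_bar_imp_0[OF w(5) w'(4) w(6) w'(7) p pq(1) pq(2) eq] le by force
  then have eq': "inverse u * u' = m * inverse m'" using eq by (simp add: tpow_0)
  have "inverse u * u' = 1"
    using Hp_eq_Hp_bar_imp_const[OF w(5) w'(4) w(6) w'(7) p pq eq'] w(8) 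
      wiener_hopf_inverse_minus_at_infty[OF p wh'] by simp
  then have "u * (inverse u * u') = u" by simp
  then show ?thesis using w(2) by (simp flip: mult.assoc)
qed

lemma wiener_hopf_plus_unique:
  assumes "1 < p" "wiener_hopf p a m \<nu> u" "wiener_hopf p a m' \<nu>' u'"
  shows "u' = u"
  using wiener_hopf_plus_unique_aux[OF assms] wiener_hopf_plus_unique_aux[OF assms(1,3,2)]
  by (cases "\<nu> \<le> \<nu>'") auto

text \<open>Uniqueness of the plus factor is what gives the description in
  \<open>fact_signature\<close> a value.\<close>

lemma fact_signature_eq:
  assumes "1 < p" "wiener_hopf p g m \<nu> u"
  shows "fact_signature p g = fourier u 0"
  unfolding fact_signature_def at_zero_def
  using assms(2) wiener_hopf_plus_unique[OF assms] by (intro the_equality) blast+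

text \<open>The powers of t cancel in \<open>g * reflect g = 1\<close>, leaving
  \<open>inverse u * reflect (inverse m) = m * reflect u\<close>, analytic on the left and
  anti-analytic on the right, so both sides are one constant. As m and its inverse are 1 at
  infinity, the constant is at once the value at 0 of u and of its inverse, and these two values
  multiply to 1.\<close>

lemma matching_wiener_hopf:
  assumes p: "1 < p" and wh: "wiener_hopf p g m \<nu> u" and g: "matching g"
  shows "fourier u 0 * fourier u 0 = 1" "reflect m = fourier u 0 *\<^sub>C inverse u"
proof -
  let ?q = "conj_exponent p"
  note pq = conj_exponent[OF p]
  note w = wiener_hopfD[OF wh]
  have rm: "reflect m * reflect (inverse m) = 1"
    using w(3) by (simp add: reflect_one flip: reflect_mult)
  have "g * reflect g = (m * reflect u) * (u * reflect m)"
    by (simp add: w(1) reflect_mult reflect_tpow mult_ac)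
  with g have g1: "(m * reflect u) * (u * reflect m) = 1" by (simp add: matching_def)
  have "inverse u * reflect (inverse m) = ((m * reflect u) * (u * reflect m)) * (inverse u * reflect (inverse m))"
    using g1 by simp
  also have "\<dots> = (m * reflect u) * (u * inverse u) * (reflect m * reflect (inverse m))" by (simp only: mult_ac)
  also have "\<dots> = m * reflect u" using w(2) rm by simp
  finally have eq: "inverse u * reflect (inverse m) = m * reflect u" .
  have refl: "reflect (inverse m) \<in> Hp ?q" "reflect u \<in> Hp_bar ?q"
    using w(4,7) Hp_reflect_iff[of "inverse m" ?q] Hp_reflect_iff[of "reflect u" ?q] by simp_all
  note const = Hp_eq_Hp_bar_imp_const[OF w(5) refl(1) w(6) refl(2) p pq eq]
  have inv0: "fourier (inverse m) 0 = 1" by (rule wiener_hopf_inverse_minus_at_infty[OF p wh])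
  have c: "fourier (inverse u) 0 = fourier u 0" using const(2) inv0 w(8) by (simp add: fourier_reflect)
  have "fourier (inverse u * u) 0 = fourier (inverse u) 0 * fourier u 0"
    by (intro fourier_Hp_mult[OF w(5,4) p pq]) simp
  then show s: "fourier u 0 * fourier u 0 = 1" using w(2) c by (simp add: fourier_one mult.commute[of _ u])
  have "m * reflect u = fourier u 0 *\<^sub>C 1" using const(1) eq c inv0 by (simp add: fourier_reflect)
  then have "reflect (m * reflect u) = fourier u 0 *\<^sub>C 1" by (simp add: reflect_cscale reflect_one)
  then have "reflect m * u = fourier u 0 *\<^sub>C 1" by (simp add: reflect_mult)
  then have "(reflect m * u) * inverse u = fourier u 0 *\<^sub>C inverse u" by (simp add: cscale_mult_left)
  then show "reflect m = fourier u 0 *\<^sub>C inverse u" using w(2) by (simp add: mult.assoc)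
qed

section \<open>Projections and linear independence read off from Fourier coefficients\<close>

lemma riesz_P_eqI:
  assumes "h \<in> Hp p" "1 \<le> p" "\<And>n. 0 \<le> n \<Longrightarrow> fourier h n = fourier f n"
  shows "riesz_P p f = h"
  unfolding riesz_P_def
proof (rule the_equality)
  show "h \<in> Hp p \<and> (\<forall>n\<ge>0. fourier h n = fourier f n)" using assms by simp
  fix k assume k: "k \<in> Hp p \<and> (\<forall>n\<ge>0. fourier k n = fourier f n)"
  then have L: "k \<in> Lp 1" "h \<in> Lp 1" using assms by (auto simp: Hp_def intro: Lp_1I)
  \<comment> \<open>Coefficients of negative index vanish by membership in H^p, the others are
    prescribed.\<close>
  have "k - h = 0"
  proof (rule fourier_unique)
    show "k - h \<in> Lp 1" using L by (intro Lp_diff) auto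
    show "fourier (k - h) n = 0" for n
      using L k assms by (cases "n < 0") (simp_all add: fourier_diff Hp_def)
  qed
  then show "k = h" by simp
qed

lemma Lp_sum:
  assumes "\<And>i. i \<in> I \<Longrightarrow> f i \<in> Lp 1" shows "(\<Sum>i\<in>I. f i) \<in> Lp 1"
  using assms by (induction I rule: infinite_finite_induct) (auto intro: Lp_add)

lemma fourier_sum:
  assumes "\<And>i. i \<in> I \<Longrightarrow> f i \<in> Lp 1" shows "fourier (\<Sum>i\<in>I. f i) n = (\<Sum>i\<in>I. fourier (f i) n)"
  using assms by (induction I rule: infinite_finite_induct) (auto simp: fourier_add Lp_sum)

text \<open>The functionals f -> \<open>fourier (u * f) (d j)\<close> are biorthogonal to the
  \<open>v k\<close> up to the nonzero scalars \<open>a j\<close>; u is there to cancel a common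
  factor of the family. Injectivity is proved as well, because independence of the image set does
  not see repetitions.\<close>

lemma independent_by_fourier:
  assumes I: "finite I" and L: "\<And>k. k \<in> I \<Longrightarrow> u * v k \<in> Lp 1"
    and dual: "\<And>j k. j \<in> I \<Longrightarrow> k \<in> I \<Longrightarrow> fourier (u * v k) (d j) = (if j = k then a j else 0)"
    and a: "\<And>j. j \<in> I \<Longrightarrow> a j \<noteq> 0"
  shows "circle.independent (v ` I)" "inj_on v I"
proof -
  show inj: "inj_on v I"
  proof (rule inj_onI)
    fix j k assume jk: "j \<in> I" "k \<in> I" "v j = v k"
    then have "fourier (u * v k) (d j) = a j" using dual[of j j] by simp
    with dual[OF jk(1,2)] a[OF jk(1)] show "j = k" by (auto split: if_splits)
  qed
  have "c w = 0" if sum0: "(\<Sum>w\<in>v ` I. c w *\<^sub>C w) = 0" and w: "w \<in> v ` I" for c w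
  proof -
    obtain j where j: "j \<in> I" "w = v j" using w by blast
    have "0 = u * (\<Sum>w\<in>v ` I. c w *\<^sub>C w)" by (simp add: sum0)
    also have "\<dots> = (\<Sum>k\<in>I. c (v k) *\<^sub>C (u * v k))"
      by (simp add: sum.reindex[OF inj] sum_distrib_left cscale_mult_right)
    finally have "0 = fourier (\<Sum>k\<in>I. c (v k) *\<^sub>C (u * v k)) (d j)" by (metis fourier_0)
    also have "\<dots> = (\<Sum>k\<in>I. c (v k) * fourier (u * v k) (d j))"
      using L by (simp add: fourier_sum Lp_cscale fourier_cscale)
    also have "\<dots> = (\<Sum>k\<in>I. if j = k then c (v k) * a j else 0)"
      using j(1) by (intro sum.cong) (auto simp: dual)
    also have "\<dots> = c (v j) * a j" using I j(1) by simp
    finally show "c w = 0" using a[OF j(1)] j by simp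
  qed
  then show "circle.independent (v ` I)"
    using I by (auto simp: circle.dependent_finite)
qed

section \<open>The kernel of the Toeplitz operator and the action of the projections\<close>

text \<open>Separates a Fredholm operator from the zero operator, whose kernel is all of
  H^p.\<close>

lemma Hp_infinite_dimensional: "\<not> finite_dimensional (Hp p)"
proof
  assume "finite_dimensional (Hp p)"
  then obtain B where B: "finite B" "Hp p \<subseteq> circle.span B" by (auto simp: finite_dimensional_def)
  \<comment> \<open>\<open>?I\<close> has one element more than B.\<close>
  let ?v = "\<lambda>k. tpow (int k)" and ?I = "{..card B}"
  have dual: "fourier (1 * ?v k) (int j) = (if j = k then 1 else 0)" for j k by (simp add: fourier_tpow)
  have indep: "circle.independent (?v ` ?I)" and inj: "inj_on ?v ?I"
    by (rule independent_by_fourier[where u = 1 and d = int and a = "\<lambda>_. 1", OF _ _ dual]; simp)+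
  have "?v ` ?I \<subseteq> circle.span B" using B(2) Hp_tpow[of _ p] by fastforce
  then have "card (?v ` ?I) \<le> card B"
    using circle.independent_span_bound[OF B(1) indep] by blast
  then show False by (simp add: card_image[OF inj])
qed

text \<open>The theorem of M. Riesz is bypassed. If no projection of \<open>g * f\<close> existed for one \<open>f\<close>, then
  \<open>toeplitz p g f\<close> would be the junk value of a \<open>THE\<close> over an empty predicate, and so would be the
  values at \<open>2f\<close> and at \<open>f + x\<close> whenever \<open>g * x\<close> has a projection. Linearity, which is part of
  being Fredholm, then forces the operator to vanish, against its kernel being finite dimensional.\<close>

lemma riesz_P_ex:
  assumes p: "1 < p" and g: "g \<in> Linf" and fred: "fredholm_Hp p (toeplitz p g)" and f: "f \<in> Hp p"
  shows "\<exists>h. h \<in> Hp p \<and> (\<forall>n\<ge>0. fourier h n = fourier (g * f) n)"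
proof (rule ccontr)
  define R where "R f h \<longleftrightarrow> h \<in> Hp p \<and> (\<forall>n\<ge>0. fourier h n = fourier (g * f) n)" for f h
  assume "\<nexists>h. h \<in> Hp p \<and> (\<forall>n\<ge>0. fourier h n = fourier (g * f) n)"
  then have nf: "\<nexists>h. R f h" by (simp add: R_def)
  define A where "A = toeplitz p g"
  define e where "e = (THE h :: circle_fun. False)"
  have A_eq: "A f = (THE h. R f h)" for f by (simp add: A_def toeplitz_def riesz_P_def R_def)
  have A_undef: "A k = e" if "\<nexists>h. R k h" for k
    unfolding A_eq e_def using that by (intro arg_cong[where f = The] ext) blast
  have A_add: "A (x + y) = A x + A y" if "x \<in> Hp p" "y \<in> Hp p" for x y
    using fred that unfolding A_def fredholm_Hp_def bounded_operator_Hp_def by blast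
  have A_scale: "A (c *\<^sub>C x) = c *\<^sub>C A x" if "x \<in> Hp p" for c x
    using fred that unfolding A_def fredholm_Hp_def bounded_operator_Hp_def by blast
  have gL: "g * x \<in> Lp 1" if "x \<in> Hp p" for x
    using that p Lp_Linf_mult[OF g, of x p] Lp_1I[of "g * x" p] by (simp add: Hp_def)
  have "\<nexists>h. R (2 *\<^sub>C f) h"
  proof
    assume "\<exists>h. R (2 *\<^sub>C f) h"
    then obtain h where "R (2 *\<^sub>C f) h" by blast
    then have "R f ((1/2) *\<^sub>C h)" by (simp add: R_def Hp_cscale fourier_cscale cscale_mult_right)
    then show False using nf by blast
  qed
  then have "e = 2 *\<^sub>C e" using A_undef[OF nf] A_undef[of "2 *\<^sub>C f"] A_scale[OF f, of 2] by simp
  moreover have "2 *\<^sub>C e = e + e" using circle.scale_left_distrib[of 1 1 e] by simp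
  ultimately have e0: "e = 0" by simp
  have "A x = 0" if x: "x \<in> Hp p" for x
  proof (cases "\<exists>h. R x h")
    case False
    then show ?thesis using A_undef e0 by simp
  next
    case True
    then obtain h where h: "R x h" by blast
    have "\<nexists>h. R (f + x) h"
    proof
      assume "\<exists>h. R (f + x) h"
      then obtain k where k: "R (f + x) k" by blast
      have L: "k \<in> Lp 1" "h \<in> Lp 1" using h k p by (auto simp: R_def Hp_def intro: Lp_1I)
      have "R f (k - h)"
        unfolding R_def
      proof (intro conjI allI impI)
        show "k - h \<in> Hp p" using h k p by (intro Hp_diff) (auto simp: R_def)
        fix n :: int assume "0 \<le> n"
        then show "fourier (k - h) n = fourier (g * f) n"
          using h k gL[OF f] gL[OF x] L by (simp add: R_def fourier_diff fourier_add distrib_left)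
      qed
      then show False using nf by blast
    qed
    then show ?thesis using A_undef[of "f + x"] A_undef[OF nf] A_add[OF f x] e0 by simp
  qed
  then have "ker_Hp p A = Hp p" by (auto simp: ker_Hp_def)
  with fred Hp_infinite_dimensional[of p] show False by (simp add: A_def fredholm_Hp_def)
qed

text \<open>The forward direction depends on the existence of the projection: a vanishing default
  value would say nothing about the coefficients.\<close>

lemma toeplitz_eq_0_iff:
  assumes p: "1 < p" and g: "g \<in> Linf" and fred: "fredholm_Hp p (toeplitz p g)" and f: "f \<in> Hp p"
  shows "toeplitz p g f = 0 \<longleftrightarrow> (\<forall>n\<ge>0. fourier (g * f) n = 0)"
proof
  assume 0: "toeplitz p g f = 0"
  obtain h where h: "h \<in> Hp p" "\<And>n. 0 \<le> n \<Longrightarrow> fourier h n = fourier (g * f) n"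
    using riesz_P_ex[OF assms] by blast
  then have "riesz_P p (g * f) = h" using p by (intro riesz_P_eqI) auto
  then have "h = 0" using 0 by (simp add: toeplitz_def)
  then show "\<forall>n\<ge>0. fourier (g * f) n = 0" using h(2) by fastforce
next
  assume "\<forall>n\<ge>0. fourier (g * f) n = 0"
  then show "toeplitz p g f = 0" unfolding toeplitz_def using p by (intro riesz_P_eqI) auto
qed

lemma subspace_ker_Hp:
  assumes "bounded_operator_Hp p A" "1 \<le> p" shows "circle.subspace (ker_Hp p A)"
proof -
  have add: "A (x + y) = A x + A y" if "x \<in> Hp p" "y \<in> Hp p" for x y
    using assms that unfolding bounded_operator_Hp_def by blast
  have scale: "A (c *\<^sub>C x) = c *\<^sub>C A x" if "x \<in> Hp p" for c x
    using assms that unfolding bounded_operator_Hp_def by blast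
  have "A 0 = 0" using scale[OF Hp_0, of 0] by simp
  then show ?thesis
    using assms(2) by (auto intro!: circle.subspaceI simp: ker_Hp_def add scale Hp_add Hp_cscale)
qed

lemma trig_poly_expansion:
  assumes x: "x \<in> Lp 1" "\<And>k. k < 0 \<or> int n \<le> k \<Longrightarrow> fourier x k = 0"
  shows "x = (\<Sum>k<n. fourier x (int k) *\<^sub>C tpow (int k))"
proof -
  let ?y = "\<Sum>k<n. fourier x (int k) *\<^sub>C tpow (int k)"
  have y: "?y \<in> Lp 1" by (intro Lp_sum Lp_cscale Lp_tpow)
  have fy: "fourier ?y j = (\<Sum>k<n. if int k = j then fourier x j else 0)" for j
    by (subst fourier_sum) (auto simp: Lp_cscale fourier_cscale fourier_tpow intro!: sum.cong)
  have "fourier ?y j = fourier x j" for j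
  proof (cases "0 \<le> j \<and> j < int n")
    case True
    then have "fourier ?y j = (\<Sum>k<n. if k = nat j then fourier x j else 0)"
      unfolding fy by (intro sum.cong) auto
    then show ?thesis using True by (simp add: nat_less_iff)
  next
    case False
    then have "fourier ?y j = 0" unfolding fy by (intro sum.neutral) auto
    then show ?thesis using False x(2)[of j] by auto
  qed
  then have "x - ?y = 0"
    using x(1) y by (intro fourier_unique) (auto intro: Lp_diff simp: fourier_diff)
  then show ?thesis by simp
qed

lemma ker_toeplitz_eq_span:
  assumes p: "1 < p" and g: "g \<in> Linf" and fred: "fredholm_Hp p (toeplitz p g)"
    and wh: "wiener_hopf p g m (- int n) u"
  shows "ker_Hp p (toeplitz p g) = circle.span ((\<lambda>k. inverse u * tpow (int k)) ` {..<n})"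
proof
  let ?q = "conj_exponent p"
  note pq = conj_exponent[OF p]
  note w = wiener_hopfD[OF wh]
  show "ker_Hp p (toeplitz p g) \<subseteq> circle.span ((\<lambda>k. inverse u * tpow (int k)) ` {..<n})"
  proof
    fix f assume "f \<in> ker_Hp p (toeplitz p g)"
    then have f: "f \<in> Hp p" "toeplitz p g f = 0" by (auto simp: ker_Hp_def)
    have gf: "\<And>k. 0 \<le> k \<Longrightarrow> fourier (g * f) k = 0" using toeplitz_eq_0_iff[OF p g fred f(1)] f(2) by simp
    \<comment> \<open>All frequencies of g f are at most -1, so after the shift by t it is still
      anti-analytic. The shift is what bounds the frequencies of f u by n - 1.\<close>
    define \<psi> where "\<psi> = tpow 1 * (g * f)"
    have \<psi>: "\<psi> \<in> Hp_bar p"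
      using f(1) p g gf by (auto simp: Hp_bar_def \<psi>_def Hp_def fourier_tpow_mult intro!: Lp_tpow_mult Lp_Linf_mult)
    have uf: "f * u \<in> Lp 1" by (rule Hp_mult_Lp[OF f(1) w(4) p pq])
    have "tpow (int n - 1) * (\<psi> * inverse m) = (tpow (int n - 1) * tpow 1 * tpow (- int n)) * (m * inverse m) * (f * u)"
      unfolding \<psi>_def w(1) by (simp only: mult_ac)
    also have "\<dots> = f * u" using w(3) by (simp add: tpow_0 flip: tpow_add)
    finally have eq: "f * u = tpow (int n - 1) * (\<psi> * inverse m)" ..
    have "fourier (f * u) k = 0" if "k < 0 \<or> int n \<le> k" for k
    proof (cases "k < 0")
      case True
      then have "fourier (f * u) k = fourier f k * fourier u 0" by (intro fourier_Hp_mult[OF f(1) w(4) p pq]) simp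
      then show ?thesis using True f(1) by (simp add: Hp_def)
    next
      case False
      then have k: "0 < k - (int n - 1)" using that by simp
      then have "fourier (\<psi> * inverse m) (k - (int n - 1)) = fourier \<psi> (k - (int n - 1)) * fourier (inverse m) 0"
        by (intro fourier_Hp_bar_mult[OF \<psi> w(7) p pq]) simp
      then show ?thesis using k \<psi> by (simp add: eq fourier_tpow_mult Hp_bar_def)
    qed
    then have "f * u = (\<Sum>k<n. fourier (f * u) (int k) *\<^sub>C tpow (int k))" using uf by (intro trig_poly_expansion)
    then have "inverse u * (f * u) = (\<Sum>k<n. fourier (f * u) (int k) *\<^sub>C (inverse u * tpow (int k)))"
      by (metis (no_types, lifting) cscale_mult_right sum.cong sum_distrib_left)
    moreover have "inverse u * (f * u) = f * (u * inverse u)" by (simp only: mult_ac)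
    then have "inverse u * (f * u) = f" using w(2) by simp
    ultimately have "f = (\<Sum>k<n. fourier (f * u) (int k) *\<^sub>C (inverse u * tpow (int k)))" by simp
    also have "\<dots> \<in> circle.span ((\<lambda>k. inverse u * tpow (int k)) ` {..<n})"
      by (intro circle.span_sum circle.span_scale circle.span_base) auto
    finally show "f \<in> circle.span ((\<lambda>k. inverse u * tpow (int k)) ` {..<n})" .
  qed
  show "circle.span ((\<lambda>k. inverse u * tpow (int k)) ` {..<n}) \<subseteq> ker_Hp p (toeplitz p g)"
  proof (rule circle.span_minimal)
    show "circle.subspace (ker_Hp p (toeplitz p g))"
      using fred p by (intro subspace_ker_Hp) (auto simp: fredholm_Hp_def)
    have "inverse u * tpow (int k) \<in> ker_Hp p (toeplitz p g)" if k: "k < n" for k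
    proof -
      have H: "inverse u * tpow (int k) \<in> Hp p" 
        using w(5) p Hp_tpow_mult[of "inverse u" p "int k"] by (simp add: mult.commute)
      have "g * (inverse u * tpow (int k)) = (tpow (- int n) * tpow (int k)) * m * (u * inverse u)"
        unfolding w(1) by (simp only: mult_ac)
      then have eq: "g * (inverse u * tpow (int k)) = tpow (- int n + int k) * m" using w(2) by (simp only: tpow_add mult_1_right)
      \<comment> \<open>The frequencies of t^(k-n) m are at most k - n < 0.\<close>
      have "toeplitz p g (inverse u * tpow (int k)) = 0"
        unfolding toeplitz_eq_0_iff[OF p g fred H] eq fourier_tpow_mult
        using w(6) k by (auto simp: Hp_bar_def)
      with H show ?thesis by (simp add: ker_Hp_def)
    qed
    then show "(\<lambda>k. inverse u * tpow (int k)) ` {..<n} \<subseteq> ker_Hp p (toeplitz p g)" by auto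
  qed
qed

text \<open>On the kernel P f = f and P (g f) = 0, so both projections in \<open>PP\<close>
  disappear.\<close>

lemma PP_eq_flip_J:
  assumes p: "1 < p" and f: "f \<in> ker_Hp p (toeplitz p g)"
  shows "PP p g f = flip_J (g * f)"
proof -
  have "riesz_P p f = f" using f p by (intro riesz_P_eqI) (auto simp: ker_Hp_def)
  then show ?thesis using f by (simp add: PP_def riesz_Q_def ker_Hp_def toeplitz_def)
qed

lemma im_PP_eq_span:
  assumes p: "1 < p" and g: "g \<in> Linf" "matching g" and fred: "fredholm_Hp p (toeplitz p g)"
    and wh: "wiener_hopf p g m (- int n) u"
  shows "im_PP s p g = circle.span
    ((\<lambda>k. (1 / 2) *\<^sub>C (inverse u * (tpow (int k) + (s * fourier u 0) *\<^sub>C tpow (int n - 1 - int k)))) ` {..<n})"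
proof -
  note w = wiener_hopfD[OF wh]
  define e where "e k = inverse u * tpow (int k)" for k
  \<comment> \<open>L agrees with the projection on the kernel, where \<open>PP\<close> is under
    control, but is linear on all functions and hence commutes with spans.\<close>
  define L where "L f = (1 / 2) *\<^sub>C (f + s *\<^sub>C flip_J (g * f))" for f
  have L_lin: "Vector_Spaces.linear cscale cscale L"
  proof
    have refl_add: "reflect (x + y) = reflect x + reflect y" for x y
      by transfer (simp add: circle_eq_def borel_recip)
    show "L (x + y) = L x + L y" for x y
      by (simp add: L_def flip_J_eq refl_add distrib_left circle.scale_right_distrib)
    show "L (c *\<^sub>C x) = c *\<^sub>C L x" for c x
      by (simp add: L_def flip_J_eq cscale_mult_right reflect_cscale circle.scale_right_distrib mult.commute)
  qed
  interpret L: Vector_Spaces.linear cscale cscale L by (rule L_lin)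
  have "im_PP s p g = L ` ker_Hp p (toeplitz p g)"
    unfolding im_PP_def L_def using PP_eq_flip_J[OF p] by (intro image_cong) auto
  also have "\<dots> = L ` circle.span (e ` {..<n})"
    unfolding e_def by (subst ker_toeplitz_eq_span[OF p g(1) fred wh]) simp
  also have "\<dots> = circle.span (L ` e ` {..<n})" by (rule L.span_image[symmetric])
  also have "L ` e ` {..<n} = (\<lambda>k. (1 / 2) *\<^sub>C (inverse u * (tpow (int k) + (s * fourier u 0) *\<^sub>C tpow (int n - 1 - int k)))) ` {..<n}"
    unfolding image_image
  proof (intro image_cong refl)
    fix k
    have "g * e k = (tpow (- int n) * tpow (int k)) * m * (u * inverse u)"
      unfolding w(1) e_def by (simp only: mult_ac)
    then have "g * e k = tpow (- int n + int k) * m" using w(2) by (simp only: tpow_add mult_1_right)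
    \<comment> \<open>Reflection turns t^(k-n) into t^(n-k), and the factor t^(-1) in J lowers this
      to t^(n-1-k).\<close>
    then have "flip_J (g * e k) = (tpow (- 1) * tpow (- (- int n + int k))) * reflect m"
      by (simp add: flip_J_eq reflect_mult reflect_tpow mult.assoc)
    also have "\<dots> = fourier u 0 *\<^sub>C (inverse u * tpow (int n - 1 - int k))"
      unfolding matching_wiener_hopf(2)[OF p wh g(2)] tpow_add[symmetric]
      by (simp add: cscale_mult_right mult.commute[of _ "inverse u"]) (simp add: algebra_simps)
    finally show "L (e k) = (1 / 2) *\<^sub>C (inverse u * (tpow (int k) + (s * fourier u 0) *\<^sub>C tpow (int n - 1 - int k)))"
      by (simp add: L_def e_def distrib_left cscale_mult_right)
  qed
  finally show ?thesis .
qed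

text \<open>Generators and proposed basis vectors correspond up to scalars, so each inclusion
  between their spans is checked one vector at a time.\<close>

lemma circle_span_scaled_subset:
  assumes "\<And>i. i \<in> I \<Longrightarrow> \<exists>c. \<exists>j\<in>J. f i = c *\<^sub>C h j"
  shows "f ` I \<subseteq> circle.span (h ` J)"
proof
  fix x assume "x \<in> f ` I"
  then obtain c j where "j \<in> J" "x = c *\<^sub>C h j" using assms by blast
  then show "x \<in> circle.span (h ` J)" by (auto intro: circle.span_scale circle.span_base)
qed

section \<open>Bases and dimensions for even and odd index\<close>

theorem theorem5p4:
  fixes p :: real and g g_minus g_plus :: circle_fun and n :: nat
  assumes "1 < p"
    and "g \<in> Linf" and "matching g"
    and "fredholm_Hp p (toeplitz p g)"
    and "fredholm_index p (toeplitz p g) = int n" and "n > 0"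
    and "wiener_hopf p g g_minus (- int n) g_plus"
  defines "\<sigma> \<equiv> fact_signature p g"
  defines "even_fun \<equiv> \<lambda>(s::complex) (m::nat) (k::nat). inverse g_plus *
             (tpow (int m - int k - 1) + (s * \<sigma>) *\<^sub>C tpow (int m + int k))"
  defines "odd_fun \<equiv> \<lambda>(s::complex) (m::nat) (k::nat). inverse g_plus *
             (tpow (int m + int k) + (s * \<sigma>) *\<^sub>C tpow (int m - int k))"
  shows "(\<forall>m. n = 2 * m \<longrightarrow>
           (\<forall>s\<in>{1, -1}.
              is_basis {even_fun s m k |k. k < m} (im_PP s p g) \<and>
              circle.dim (im_PP s p g) = m)) \<and>
         (\<forall>m. n = 2 * m + 1 \<longrightarrow>
           (\<forall>s\<in>{1, -1}.
              is_basis ({odd_fun s m k |k. k \<le> m} - {0}) (im_PP s p g) \<and>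
              of_nat (circle.dim (im_PP s p g)) = of_nat m + (1 + s * \<sigma>) / 2) \<and>
           (\<exists>s0\<in>{1, -1}.
              (1 + s0 * \<sigma>) *\<^sub>C tpow (int m) = 0 \<and>
              (\<forall>s\<in>{1, -1}. \<forall>k\<le>m. odd_fun s m k = 0 \<longleftrightarrow> s = s0 \<and> k = 0)))"
proof -
  note p = assms(1) and wh = assms(7)
  note w = wiener_hopfD[OF wh]
  have \<sigma>: "\<sigma> = fourier g_plus 0" unfolding \<sigma>_def by (rule fact_signature_eq[OF p wh])
  then have "\<sigma> * \<sigma> = 1" using matching_wiener_hopf(1)[OF p wh assms(3)] by simp
  then have \<sigma>_cases: "\<sigma> = 1 \<or> \<sigma> = -1" using square_eq_1_iff by blast
  define v where "v \<tau> k l = inverse g_plus * (tpow k + \<tau> *\<^sub>C tpow l)" for \<tau> k l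
  have v_mult: "g_plus * v \<tau> k l = tpow k + \<tau> *\<^sub>C tpow l" for \<tau> k l
    using w(2) by (simp add: v_def flip: mult.assoc)
  have v_Lp: "g_plus * v \<tau> k l \<in> Lp 1" for \<tau> k l
    unfolding v_mult by (intro Lp_add Lp_cscale Lp_tpow) simp
  have v_fourier: "fourier (g_plus * v \<tau> k l) j = (if j = k then 1 else 0) + (if j = l then \<tau> else 0)" for \<tau> k l j
    unfolding v_mult by (subst fourier_add) (auto simp: Lp_cscale fourier_cscale fourier_tpow)
  \<comment> \<open>Exchanging the exponents costs only the sign \<open>\<tau>\<close>, so the
    generators with indices j and n - 1 - j are proportional.\<close>
  have v_swap: "v \<tau> k l = \<tau> *\<^sub>C v \<tau> l k" if "\<tau> * \<tau> = 1" for \<tau> k l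
    using that by (simp add: v_def distrib_left circle.scale_right_distrib cscale_mult_right add.commute)
  have im: "im_PP s p g = circle.span ((\<lambda>k. (1 / 2) *\<^sub>C v (s * \<sigma>) (int k) (int n - 1 - int k)) ` {..<n})" for s
    unfolding v_def \<sigma> by (rule im_PP_eq_span[OF p assms(2,3,4) wh])
  have \<tau>: "s * \<sigma> * (s * \<sigma>) = 1" "s * \<sigma> \<noteq> 0" if "s \<in> {1, -1}" for s
    using that \<sigma>_cases by auto
  have even: "is_basis {even_fun s m k |k. k < m} (im_PP s p g) \<and> circle.dim (im_PP s p g) = m"
    if n: "n = 2 * m" and s: "s \<in> {1, -1}" for m s
  proof -
    let ?E = "even_fun s m" and ?\<tau> = "s * \<sigma>"
    let ?L = "\<lambda>k. (1 / 2) *\<^sub>C v ?\<tau> (int k) (int n - 1 - int k)"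
    have E: "?E k = v ?\<tau> (int m - int k - 1) (int m + int k)" for k by (simp add: even_fun_def v_def)
    have "circle.independent (?E ` {..<m})" "inj_on ?E {..<m}"
      \<comment> \<open>The frequency m + k occurs in the k-th vector alone, with coefficient
        \<open>?\<tau>\<close>.\<close>
      by (rule independent_by_fourier[where u = g_plus and d = "\<lambda>k. int m + int k" and a = "\<lambda>_. ?\<tau>"];
        use \<tau>[OF s] in \<open>auto simp: E v_Lp v_fourier\<close>)+
    note indep = this
    have "circle.span (?E ` {..<m}) = im_PP s p g"
      unfolding im circle.span_eq
    proof (intro conjI circle_span_scaled_subset)
      fix k assume "k \<in> {..<m}"
      then have k: "m - k - 1 \<in> {..<n}" and idx: "int (m - k - 1) = int m - int k - 1"
        "int n - 1 - (int m - int k - 1) = int m + int k"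
        using n by auto
      have "?E k = 2 *\<^sub>C ?L (m - k - 1)" unfolding idx E by simp
      with k show "\<exists>c. \<exists>j\<in>{..<n}. ?E k = c *\<^sub>C ?L j" by blast
    next
      fix j assume j: "j \<in> {..<n}"
      show "\<exists>c. \<exists>k\<in>{..<m}. ?L j = c *\<^sub>C ?E k"
      \<comment> \<open>An index j = m - 1 - k in the lower half gives the k-th basis vector
        directly, j = m + k in the upper half after a swap.\<close>
      proof (cases "j < m")
        case True
        then have k: "m - 1 - j \<in> {..<m}" and idx: "int (m - 1 - j) = int m - 1 - int j" by auto
        have idx': "int j = int m - (int m - 1 - int j) - 1" "int n - 1 - int j = int m + (int m - 1 - int j)"
          using n by auto
        have "?L j = (1 / 2) *\<^sub>C ?E (m - 1 - j)" unfolding E idx idx'[symmetric] ..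
        with k show ?thesis by blast
      next
        case False
        then have k: "j - m \<in> {..<m}" and idx: "int (j - m) = int j - int m" using j n by auto
        have idx': "int n - 1 - int j = int m - (int j - int m) - 1" "int j = int m + (int j - int m)"
          using n by auto
        have "?L j = (1 / 2) *\<^sub>C ?\<tau> *\<^sub>C v ?\<tau> (int n - 1 - int j) (int j)"
          by (subst v_swap[OF \<tau>(1)[OF s]]) simp
        also have "\<dots> = (?\<tau> / 2) *\<^sub>C ?E (j - m)" unfolding E idx idx'[symmetric] by simp
        finally show ?thesis using k by blast
      qed
    qed
    moreover have "{even_fun s m k |k. k < m} = ?E ` {..<m}" by auto
    ultimately show ?thesis
      using indep circle.dim_span_eq_card_independent[OF indep(1)] by (simp add: is_basis_def card_image)
  qed
  have odd_zero: "odd_fun s m k = 0 \<longleftrightarrow> s = - \<sigma> \<and> k = 0" if s: "s \<in> {1, -1}" for s m k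
  proof
    assume "odd_fun s m k = 0"
    then have "fourier (g_plus * v (s * \<sigma>) (int m + int k) (int m - int k)) (int m + int k) = 0"
      by (simp add: odd_fun_def v_def)
    \<comment> \<open>For k > 0 the coefficient at m + k is 1; for k = 0 the two exponents coincide
      and it is 1 + s \<sigma>.\<close>
    then have "k = 0 \<and> 1 + s * \<sigma> = 0" unfolding v_fourier by (auto split: if_splits)
    then show "s = - \<sigma> \<and> k = 0" using s \<sigma>_cases by auto
  next
    assume "s = - \<sigma> \<and> k = 0"
    then show "odd_fun s m k = 0" using \<sigma>_cases by (auto simp: odd_fun_def)
  qed
  have odd: "is_basis ({odd_fun s m k |k. k \<le> m} - {0}) (im_PP s p g) \<and>
      of_nat (circle.dim (im_PP s p g)) = of_nat m + (1 + s * \<sigma>) / 2"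
    if n: "n = 2 * m + 1" and s: "s \<in> {1, -1}" for m s
  proof -
    let ?O = "odd_fun s m" and ?\<tau> = "s * \<sigma>"
    let ?L = "\<lambda>k. (1 / 2) *\<^sub>C v ?\<tau> (int k) (int n - 1 - int k)"
    \<comment> \<open>The index 0 is left out exactly when its vector is zero.\<close>
    define I where "I = (if s = - \<sigma> then {1..m} else {0..m})"
    have O: "?O k = v ?\<tau> (int m + int k) (int m - int k)" for k by (simp add: odd_fun_def v_def)
    have \<tau>_neq: "1 + ?\<tau> \<noteq> 0" if "s \<noteq> - \<sigma>" using that s \<sigma>_cases by auto
    have "circle.independent (?O ` I)" "inj_on ?O I"
      by (rule independent_by_fourier[where u = g_plus and d = "\<lambda>k. int m + int k" and a = "\<lambda>k. if k = 0 then 1 + ?\<tau> else 1"];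
        use \<tau>_neq in \<open>auto simp: O v_Lp v_fourier I_def split: if_splits\<close>)+
    note indep = this
    have B: "{odd_fun s m k |k. k \<le> m} - {0} = ?O ` I"
    proof -
      have "I = {k. k \<le> m \<and> \<not> (s = - \<sigma> \<and> k = 0)}" unfolding I_def by (cases "s = - \<sigma>") auto
      then have I_eq: "I = {k. k \<le> m \<and> ?O k \<noteq> 0}" unfolding odd_zero[OF s] .
      show ?thesis unfolding I_eq by auto
    qed
    have all: "{odd_fun s m k |k. k \<le> m} = ?O ` {..m}" by auto
    have "circle.span (?O ` {..m}) = im_PP s p g"
      unfolding im circle.span_eq
    proof (intro conjI circle_span_scaled_subset)
      fix k assume "k \<in> {..m}"
      then have k: "m + k \<in> {..<n}" and idx: "int (m + k) = int m + int k" "int n - 1 - (int m + int k) = int m - int k"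
        using n by auto
      have "?O k = 2 *\<^sub>C ?L (m + k)" unfolding idx O by simp
      with k show "\<exists>c. \<exists>j\<in>{..<n}. ?O k = c *\<^sub>C ?L j" by blast
    next
      fix j assume j: "j \<in> {..<n}"
      show "\<exists>c. \<exists>k\<in>{..m}. ?L j = c *\<^sub>C ?O k"
      \<comment> \<open>Here the exponent m + k comes first, so it is the lower half that needs the
        swap.\<close>
      proof (cases "j < m")
        case True
        then have k: "m - j \<in> {..m}" and idx: "int (m - j) = int m - int j" by auto
        have idx': "int n - 1 - int j = int m + (int m - int j)" "int j = int m - (int m - int j)"
          using n by auto
        have "?L j = (1 / 2) *\<^sub>C ?\<tau> *\<^sub>C v ?\<tau> (int n - 1 - int j) (int j)"
          by (subst v_swap[OF \<tau>(1)[OF s]]) simp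
        also have "\<dots> = (?\<tau> / 2) *\<^sub>C ?O (m - j)" unfolding O idx idx'[symmetric] by simp
        finally show ?thesis using k by blast
      next
        case False
        then have k: "j - m \<in> {..m}" and idx: "int (j - m) = int j - int m" using j n by auto
        have idx': "int j = int m + (int j - int m)" "int n - 1 - int j = int m - (int j - int m)"
          using n by auto
        have "?L j = (1 / 2) *\<^sub>C ?O (j - m)" unfolding O idx idx'[symmetric] ..
        with k show ?thesis by blast
      qed
    qed
    \<comment> \<open>Deleting the zero vector does not change the span.\<close>
    then have span: "circle.span (?O ` I) = im_PP s p g" by (simp add: all flip: B)
    \<comment> \<open>There are m indices if s \<sigma> = -1 and m + 1 if s \<sigma> = 1.\<close>
    have "of_nat (card I) = of_nat m + (1 + s * \<sigma>) / 2"
      using s \<sigma>_cases by (auto simp: I_def)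
    then show ?thesis
      using indep span circle.dim_span_eq_card_independent[OF indep(1)]
      unfolding B by (simp add: is_basis_def card_image)
  qed
  \<comment> \<open>The sign with vanishing middle vector is s0 = -\<sigma>.\<close>
  have "(1 + - \<sigma> * \<sigma>) *\<^sub>C tpow (int m) = 0" for m :: nat
    using \<open>\<sigma> * \<sigma> = 1\<close> by simp
  moreover have "- \<sigma> \<in> {1, -1}" using \<sigma>_cases by auto
  ultimately have "\<exists>s0\<in>{1, -1}. (1 + s0 * \<sigma>) *\<^sub>C tpow (int m) = 0 \<and>
      (\<forall>s\<in>{1, -1}. \<forall>k\<le>m. odd_fun s m k = 0 \<longleftrightarrow> s = s0 \<and> k = 0)" for m :: nat
    using odd_zero by blast
  with even odd show ?thesis by blast
qed

end
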